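(* Let $X$ be an almost homogeneous compact complex manifold of dimension $n$. Let $\mathcal B=\{s^{(1)},\dots,s^{(n)}\}\subset H^0(X,T_X)$ be a set of $n$ global holomorphic vector fields which generate $T_X$ at the general point, and let $V\subset H^0(X,T_X)$ be the complex vector space spanned by $\mathcal B$. Then the zero locus of $s^{(1)}\wedge\dots\wedge s^{(n)}$ is a divisor $D_V\in|-K_X|$, and the hermitian metric $g_{\mathcal B}$ on $X\setminus D_V$ for which $(s^{(1)},\dots,s^{(n)})$ is a unitary frame at every point is Ricci-flat. The metric $g_{\mathcal B}$ is Kähler if and only if $V$ is abelian, i.e. $[\zeta,\xi]=0$ for all $\zeta,\xi\in V$.
   Context: A compact complex manifold $X$ is almost homogeneous if there is a Lie group $G\subset\mathrm{Aut}(X)$ whose action on $X$ has an open orbit (equivalently, whose Lie algebra, viewed in $H^0(X,T_X)$, generates $T_X$ at the general point). $D_V$ is the divisor of zeros of the section $s^{(1)}\wedge\dots\wedge s^{(n)}$ of $\bigwedge^n T_X=-K_X$. The metric $g_{\mathcal B}$ is given in local coordinates as follows: write $s^{(i)}=\sum_k s^{ik}\frac{\partial}{\partial z^k}$ and let $(s_{ij})$ be the inverse of the matrix $(s^{ij})$ on $X\setminus D_V$; then $g_{\mathcal B,i\bar j}=\sum_k s_{ik}\overline{s_{jk}}$. For a (not necessarily Kähler) hermitian metric $g$, Ricci-flat means that $\mathrm{Ric}(g)=\frac{i}{2\pi}\partial\bar\partial\log\det g=0$. The space $V$ is not required to be a Lie subalgebra. *)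

theory Defs
  imports "HOL-Analysis.Analysis" "HOL-Algebra.Bij"
begin

section \<open>Regularity of maps between finite-dimensional vector spaces\<close>

text \<open>All sets \<open>S\<close> below are open in the applications, so that the derivative at a point
  of \<open>S\<close> only depends on the values of the map on \<open>S\<close>.\<close>

definition holo_on :: "(complex^'n) set \<Rightarrow> (complex^'n \<Rightarrow> complex) \<Rightarrow> bool" where
  "holo_on S f \<longleftrightarrow>
     (\<forall>z\<in>S. \<exists>D. (f has_derivative D) (at z) \<and> (\<forall>a v. D (a *s v) = a * D v))"

definition holo_vec_on :: "(complex^'n) set \<Rightarrow> (complex^'n \<Rightarrow> complex^'m) \<Rightarrow> bool" where
  "holo_vec_on S f \<longleftrightarrow> (\<forall>k. holo_on S (\<lambda>z. f z $ k))"

primrec Ck_on :: "nat \<Rightarrow> 'e set \<Rightarrow> ('e::real_normed_vector \<Rightarrow> 'f::real_normed_vector) \<Rightarrow> bool" where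
  "Ck_on 0 S f \<longleftrightarrow> continuous_on S f"
| "Ck_on (Suc k) S f \<longleftrightarrow>
     (\<forall>x\<in>S. f differentiable (at x)) \<and> (\<forall>v. Ck_on k S (\<lambda>x. frechet_derivative f (at x) v))"

definition smooth_on :: "'e set \<Rightarrow> ('e::real_normed_vector \<Rightarrow> 'f::real_normed_vector) \<Rightarrow> bool" where
  "smooth_on S f \<longleftrightarrow> (\<forall>k. Ck_on k S f)"

section \<open>Charts, atlases, manifolds\<close>

text \<open>A chart is a pair (domain, coordinate map); the values of the coordinate map outside
  the domain are irrelevant.\<close>

type_synonym ('a, 'e) chart = "'a set \<times> ('a \<Rightarrow> 'e)"

abbreviation cdom :: "('a, 'e) chart \<Rightarrow> 'a set" where "cdom c \<equiv> fst c"
abbreviation coord :: "('a, 'e) chart \<Rightarrow> 'a \<Rightarrow> 'e" where "coord c \<equiv> snd c"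

definition chart_inv :: "('a, 'e) chart \<Rightarrow> 'e \<Rightarrow> 'a" where
  "chart_inv c = inv_into (cdom c) (coord c)"

definition is_chart :: "'a topology \<Rightarrow> ('a, 'e::euclidean_space) chart \<Rightarrow> bool" where
  "is_chart X c \<longleftrightarrow> openin X (cdom c) \<and> open (coord c ` cdom c) \<and>
     homeomorphic_map (subtopology X (cdom c)) (top_of_set (coord c ` cdom c)) (coord c)"

definition transition :: "('a, 'e) chart \<Rightarrow> ('a, 'e) chart \<Rightarrow> 'e \<Rightarrow> 'e" where
  "transition c d = coord d \<circ> chart_inv c"

text \<open>\<open>P\<close> is the regularity required of coordinate expressions (holomorphic or smooth).\<close>

definition is_atlas ::
  "('e set \<Rightarrow> ('e \<Rightarrow> 'e) \<Rightarrow> bool) \<Rightarrow> 'a topology \<Rightarrow> ('a, 'e::euclidean_space) chart set \<Rightarrow> bool" where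
  "is_atlas P X A \<longleftrightarrow> (\<forall>c\<in>A. is_chart X c) \<and> (\<Union>c\<in>A. cdom c) = topspace X \<and>
     (\<forall>c\<in>A. \<forall>d\<in>A. P (coord c ` (cdom c \<inter> cdom d)) (transition c d))"

definition is_manifold ::
  "('e set \<Rightarrow> ('e \<Rightarrow> 'e) \<Rightarrow> bool) \<Rightarrow> 'a topology \<Rightarrow> ('a, 'e::euclidean_space) chart set \<Rightarrow> bool" where
  "is_manifold P X A \<longleftrightarrow> Hausdorff_space X \<and> second_countable X \<and> is_atlas P X A"

definition manifold_map ::
  "('e set \<Rightarrow> ('e \<Rightarrow> 'f) \<Rightarrow> bool) \<Rightarrow> 'a topology \<Rightarrow> ('a, 'e) chart set
     \<Rightarrow> 'b topology \<Rightarrow> ('b, 'f) chart set \<Rightarrow> ('a \<Rightarrow> 'b) \<Rightarrow> bool" where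
  "manifold_map P X A Y B f \<longleftrightarrow> continuous_map X Y f \<and>
     (\<forall>c\<in>A. \<forall>d\<in>B. P (coord c ` {p \<in> cdom c. f p \<in> cdom d}) (coord d \<circ> f \<circ> chart_inv c))"

definition prod_atlas ::
  "('a, 'e) chart set \<Rightarrow> ('b, 'f) chart set \<Rightarrow> ('a \<times> 'b, 'e \<times> 'f) chart set" where
  "prod_atlas A B = {(cdom c \<times> cdom d, map_prod (coord c) (coord d)) |c d. c \<in> A \<and> d \<in> B}"

text \<open>Compact complex manifolds are connected, as usual.\<close>

definition compact_complex_manifold ::
  "'a topology \<Rightarrow> ('a, complex^'n) chart set \<Rightarrow> bool" where
  "compact_complex_manifold X A \<longleftrightarrow>
     is_manifold holo_vec_on X A \<and> compact_space X \<and> connected_space X \<and> topspace X \<noteq> {}"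

definition holo_fun ::
  "('a, complex^'n) chart set \<Rightarrow> 'a set \<Rightarrow> ('a \<Rightarrow> complex) \<Rightarrow> bool" where
  "holo_fun A U f \<longleftrightarrow> (\<forall>c\<in>A. holo_on (coord c ` (cdom c \<inter> U)) (f \<circ> chart_inv c))"

section \<open>Almost homogeneous manifolds\<close>

definition Aut :: "'a topology \<Rightarrow> ('a, complex^'n) chart set \<Rightarrow> ('a \<Rightarrow> 'a) set" where
  "Aut X A = {f \<in> Bij (topspace X). manifold_map holo_vec_on X A X A f \<and>
     manifold_map holo_vec_on X A X A (inv_into (topspace X) f)}"

text \<open>The group \<open>G\<close> carries the manifold structure given by the topology \<open>T\<close> on its carrier and
  the atlas \<open>C\<close>.\<close>

definition lie_group ::
  "('g, 'm) monoid_scheme \<Rightarrow> 'g topology \<Rightarrow> ('g, 'e::euclidean_space) chart set \<Rightarrow> bool" where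
  "lie_group G T C \<longleftrightarrow> Group.group G \<and> topspace T = carrier G \<and> is_manifold smooth_on T C \<and>
     manifold_map smooth_on (prod_topology T T) (prod_atlas C C) T C (\<lambda>(g, h). g \<otimes>\<^bsub>G\<^esub> h) \<and>
     manifold_map smooth_on T C T C (\<lambda>g. inv\<^bsub>G\<^esub> g)"

text \<open>The type argument is the Euclidean space on which the (real) Lie group is modelled.
  Its dimension is positive, which is no restriction: an orbit of a zero-dimensional
  (hence countable) Lie group is never open in a manifold of positive dimension.\<close>

definition almost_homogeneous ::
  "'e::euclidean_space itself \<Rightarrow> 'a topology \<Rightarrow> ('a, complex^'n) chart set \<Rightarrow> bool" where
  "almost_homogeneous _ X A \<longleftrightarrow>
     (\<exists>G (T :: ('a \<Rightarrow> 'a) topology) (C :: ('a \<Rightarrow> 'a, 'e) chart set).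
        G \<subseteq> Aut X A \<and> subgroup G (BijGroup (topspace X)) \<and>
        lie_group ((BijGroup (topspace X))\<lparr>carrier := G\<rparr>) T C \<and>
        manifold_map smooth_on (prod_topology T X) (prod_atlas C A) X A (\<lambda>(g, p). g p) \<and>
        (\<exists>p\<in>topspace X. openin X ((\<lambda>g. g p) ` G)))"

section \<open>The general point\<close>

definition analytic_subset ::
  "'a topology \<Rightarrow> ('a, complex^'n) chart set \<Rightarrow> 'a set \<Rightarrow> bool" where
  "analytic_subset X A Z \<longleftrightarrow> Z \<subseteq> topspace X \<and>
     (\<forall>p\<in>topspace X. \<exists>U F. openin X U \<and> p \<in> U \<and> finite F \<and> (\<forall>f\<in>F. holo_fun A U f) \<and>
        Z \<inter> U = {q \<in> U. \<forall>f\<in>F. f q = 0})"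

definition holds_at_general_point ::
  "'a topology \<Rightarrow> ('a, complex^'n) chart set \<Rightarrow> ('a \<Rightarrow> bool) \<Rightarrow> bool" where
  "holds_at_general_point X A P \<longleftrightarrow>
     (\<exists>Z. analytic_subset X A Z \<and> Z \<noteq> topspace X \<and> (\<forall>p\<in>topspace X - Z. P p))"

section \<open>Holomorphic vector fields\<close>

text \<open>A section of the tangent bundle is given by its component vectors with respect to the
  coordinate frames of the charts: \<open>s c p $ k\<close> is the coefficient of the \<open>k\<close>-th coordinate
  vector field of the chart \<open>c\<close> at the point \<open>p \<in> cdom c\<close>. Values at \<open>p \<notin> cdom c\<close> are
  irrelevant.\<close>

type_synonym ('a, 'n) vfield = "('a, complex^'n) chart \<Rightarrow> 'a \<Rightarrow> complex^'n"

definition transition_deriv ::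
  "('a, complex^'n) chart \<Rightarrow> ('a, complex^'n) chart \<Rightarrow> 'a \<Rightarrow> complex^'n \<Rightarrow> complex^'n" where
  "transition_deriv c d p = frechet_derivative (transition c d) (at (coord c p))"

definition holomorphic_vector_field ::
  "('a, complex^'n) chart set \<Rightarrow> ('a, 'n) vfield \<Rightarrow> bool" where
  "holomorphic_vector_field A s \<longleftrightarrow>
     (\<forall>c\<in>A. \<forall>k. holo_fun A (cdom c) (\<lambda>p. s c p $ k)) \<and>
     (\<forall>c\<in>A. \<forall>d\<in>A. \<forall>p\<in>cdom c \<inter> cdom d. s d p = transition_deriv c d p (s c p))"

definition generate_tangent_space ::
  "('a, complex^'n) chart set \<Rightarrow> ('n \<Rightarrow> ('a, 'n) vfield) \<Rightarrow> 'a \<Rightarrow> bool" where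
  "generate_tangent_space A s p \<longleftrightarrow>
     (\<forall>c\<in>A. p \<in> cdom c \<longrightarrow> vec.span (range (\<lambda>i. s i c p)) = UNIV)"

definition vfield_span :: "('n::finite \<Rightarrow> ('a, 'n) vfield) \<Rightarrow> ('a, 'n) vfield set" where
  "vfield_span s = {\<lambda>c p. \<Sum>i\<in>UNIV. a i *s s i c p |a. True}"

definition lie_bracket :: "('a, 'n::finite) vfield \<Rightarrow> ('a, 'n) vfield \<Rightarrow> ('a, 'n) vfield" where
  "lie_bracket \<zeta> \<xi> c p =
     frechet_derivative (\<xi> c \<circ> chart_inv c) (at (coord c p)) (\<zeta> c p)
     - frechet_derivative (\<zeta> c \<circ> chart_inv c) (at (coord c p)) (\<xi> c p)"

definition abelian :: "('a, complex^'n) chart set \<Rightarrow> ('a, 'n) vfield set \<Rightarrow> bool" where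
  "abelian A V \<longleftrightarrow>
     (\<forall>\<zeta>\<in>V. \<forall>\<xi>\<in>V. \<forall>c\<in>A. \<forall>p\<in>cdom c. lie_bracket \<zeta> \<xi> c p = 0)"

section \<open>Line bundles and divisors\<close>

text \<open>A line bundle is given by trivialisations over an open cover and a cocycle: if \<open>v\<^sub>i\<close>
  denotes the coordinate with respect to the trivialisation \<open>i\<close>, then
  \<open>v\<^sub>j = lb_cocycle L i j p * v\<^sub>i\<close> in the fibre over \<open>p\<close>.\<close>

record ('a, 'i) line_bundle =
  lb_index :: "'i set"
  lb_dom :: "'i \<Rightarrow> 'a set"
  lb_cocycle :: "'i \<Rightarrow> 'i \<Rightarrow> 'a \<Rightarrow> complex"

definition holo_section ::
  "('a, complex^'n) chart set \<Rightarrow> ('a, 'i) line_bundle \<Rightarrow> ('i \<Rightarrow> 'a \<Rightarrow> complex) \<Rightarrow> bool" where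
  "holo_section A L \<sigma> \<longleftrightarrow>
     (\<forall>i\<in>lb_index L. holo_fun A (lb_dom L i) (\<sigma> i)) \<and>
     (\<forall>i\<in>lb_index L. \<forall>j\<in>lb_index L. \<forall>p\<in>lb_dom L i \<inter> lb_dom L j.
        \<sigma> j p = lb_cocycle L i j p * \<sigma> i p)"

definition section_zeros :: "('a, 'i) line_bundle \<Rightarrow> ('i \<Rightarrow> 'a \<Rightarrow> complex) \<Rightarrow> 'a set" where
  "section_zeros L \<sigma> = {p. \<exists>i\<in>lb_index L. p \<in> lb_dom L i \<and> \<sigma> i p = 0}"

definition holo_unit ::
  "('a, complex^'n) chart set \<Rightarrow> 'a set \<Rightarrow> ('a \<Rightarrow> complex) \<Rightarrow> bool" where
  "holo_unit A U u \<longleftrightarrow> holo_fun A U u \<and> (\<forall>p\<in>U. u p \<noteq> 0)"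

definition line_bundle_iso ::
  "('a, complex^'n) chart set \<Rightarrow> ('a, 'i) line_bundle \<Rightarrow> ('a, 'j) line_bundle \<Rightarrow> bool" where
  "line_bundle_iso A L M \<longleftrightarrow> (\<exists>\<phi> :: 'i \<Rightarrow> 'j \<Rightarrow> 'a \<Rightarrow> complex.
     (\<forall>i\<in>lb_index L. \<forall>j\<in>lb_index M. holo_unit A (lb_dom L i \<inter> lb_dom M j) (\<phi> i j)) \<and>
     (\<forall>i\<in>lb_index L. \<forall>i'\<in>lb_index L. \<forall>j\<in>lb_index M. \<forall>j'\<in>lb_index M.
        \<forall>p\<in>lb_dom L i \<inter> lb_dom L i' \<inter> lb_dom M j \<inter> lb_dom M j'.
          \<phi> i' j' p * lb_cocycle L i i' p = lb_cocycle M j j' p * \<phi> i j p))"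

text \<open>The anticanonical bundle, i.e. the top exterior power of the tangent bundle. Over a chart
  it is trivialised by the wedge product of the coordinate vector fields, hence the
  coordinates of its elements transform with the determinant of the Jacobian matrix.\<close>

definition anticanonical_bundle ::
  "('a, complex^'n) chart set \<Rightarrow> ('a, ('a, complex^'n) chart) line_bundle" where
  "anticanonical_bundle A = \<lparr>lb_index = A, lb_dom = cdom,
     lb_cocycle = (\<lambda>c d p. det (matrix (transition_deriv c d p)))\<rparr>"

text \<open>The matrix \<open>(s\<^sup>i\<^sup>k)\<close> of the components of the fields; the wedge product of the fields is its
  determinant times the wedge product of the coordinate vector fields.\<close>

definition frame_matrix ::
  "('n \<Rightarrow> ('a, 'n) vfield) \<Rightarrow> ('a, complex^'n) chart \<Rightarrow> 'a \<Rightarrow> complex^'n^'n" where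
  "frame_matrix s c p = (\<chi> i k. s i c p $ k)"

definition wedge ::
  "('n \<Rightarrow> ('a, 'n) vfield) \<Rightarrow> ('a, complex^'n) chart \<Rightarrow> 'a \<Rightarrow> complex" where
  "wedge s c p = det (frame_matrix s c p)"

text \<open>Effective (Cartier) divisors are represented by the set of all their local equations
  \<open>(U, f)\<close>, so that equality of divisors is equality of sets.\<close>

type_synonym 'a divisor = "('a set \<times> ('a \<Rightarrow> complex)) set"

definition local_equation ::
  "'a topology \<Rightarrow> ('a, complex^'n) chart set \<Rightarrow> 'a set \<Rightarrow> ('a \<Rightarrow> complex) \<Rightarrow> bool" where
  "local_equation X A U f \<longleftrightarrow> openin X U \<and> holo_fun A U f \<and>
     (\<forall>W. openin X W \<and> W \<subseteq> U \<and> W \<noteq> {} \<longrightarrow> (\<exists>p\<in>W. f p \<noteq> 0))"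

definition associated ::
  "('a, complex^'n) chart set \<Rightarrow> 'a set \<Rightarrow> ('a \<Rightarrow> complex) \<Rightarrow> ('a \<Rightarrow> complex) \<Rightarrow> bool" where
  "associated A U f h \<longleftrightarrow> (\<exists>u. holo_unit A U u \<and> (\<forall>p\<in>U. h p = u p * f p))"

definition effective_divisor ::
  "'a topology \<Rightarrow> ('a, complex^'n) chart set \<Rightarrow> 'a divisor \<Rightarrow> bool" where
  "effective_divisor X A D \<longleftrightarrow> (\<Union>(U, f)\<in>D. U) = topspace X \<and>
     D = {(U, f). local_equation X A U f \<and> (\<forall>(V, h)\<in>D. associated A (U \<inter> V) f h)}"

definition divisor_support :: "'a divisor \<Rightarrow> 'a set" where
  "divisor_support D = {p. \<exists>(U, f)\<in>D. p \<in> U \<and> f p = 0}"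

definition divisor_of_zeros ::
  "'a topology \<Rightarrow> ('a, complex^'n) chart set \<Rightarrow> ('a, 'i) line_bundle
     \<Rightarrow> ('i \<Rightarrow> 'a \<Rightarrow> complex) \<Rightarrow> 'a divisor" where
  "divisor_of_zeros X A L \<sigma> = {(U, f). local_equation X A U f \<and>
     (\<forall>i\<in>lb_index L. associated A (U \<inter> lb_dom L i) f (\<sigma> i))}"

text \<open>The line bundle \<open>O(D)\<close>, whose sections are the meromorphic functions \<open>m\<close> with \<open>m * f\<close>
  holomorphic for every local equation \<open>f\<close>. Over \<open>(U, f) \<in> D\<close> it is trivialised by
  \<open>m \<mapsto> m * f\<close>, so its cocycle is \<open>h / f\<close>, extended over the zeros of \<open>f\<close>.\<close>

definition unit_quotient ::
  "('a, complex^'n) chart set \<Rightarrow> 'a set \<Rightarrow> ('a \<Rightarrow> complex) \<Rightarrow> ('a \<Rightarrow> complex) \<Rightarrow> 'a \<Rightarrow> complex" where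
  "unit_quotient A U h f p =
     (THE y. \<exists>u. holo_unit A U u \<and> (\<forall>q\<in>U. h q = u q * f q) \<and> u p = y)"

definition divisor_line_bundle ::
  "('a, complex^'n) chart set \<Rightarrow> 'a divisor \<Rightarrow> ('a, 'a set \<times> ('a \<Rightarrow> complex)) line_bundle" where
  "divisor_line_bundle A D = \<lparr>lb_index = D, lb_dom = fst,
     lb_cocycle = (\<lambda>(U, f) (V, h). unit_quotient A (U \<inter> V) h f)\<rparr>"

definition complete_linear_system ::
  "'a topology \<Rightarrow> ('a, complex^'n) chart set \<Rightarrow> ('a, 'i) line_bundle \<Rightarrow> 'a divisor set" where
  "complete_linear_system X A L =
     {D. effective_divisor X A D \<and> line_bundle_iso A (divisor_line_bundle A D) L}"

section \<open>Hermitian metrics\<close>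

text \<open>As for vector fields, \<open>g c p $ i $ j\<close> is the coefficient of the metric at \<open>p\<close>
  in the chart \<open>c\<close>.\<close>

type_synonym ('a, 'n) metric = "('a, complex^'n) chart \<Rightarrow> 'a \<Rightarrow> complex^'n^'n"

definition herm :: "complex^'n^'n \<Rightarrow> complex^'n \<Rightarrow> complex^'n \<Rightarrow> complex" where
  "herm G v w = (\<Sum>i\<in>UNIV. \<Sum>j\<in>UNIV. G $ i $ j * v $ i * cnj (w $ j))"

definition hermitian_metric ::
  "('a, complex^'n) chart set \<Rightarrow> 'a set \<Rightarrow> ('a, 'n) metric \<Rightarrow> bool" where
  "hermitian_metric A W g \<longleftrightarrow>
     (\<forall>c\<in>A. \<forall>p\<in>cdom c \<inter> W.
        (\<forall>v w. herm (g c p) w v = cnj (herm (g c p) v w)) \<and>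
        (\<forall>v. v \<noteq> 0 \<longrightarrow> 0 < Re (herm (g c p) v v))) \<and>
     (\<forall>c\<in>A. \<forall>i j. smooth_on (coord c ` (cdom c \<inter> W)) (\<lambda>z. g c (chart_inv c z) $ i $ j)) \<and>
     (\<forall>c\<in>A. \<forall>d\<in>A. \<forall>p\<in>cdom c \<inter> cdom d \<inter> W. \<forall>v w.
        herm (g d p) (transition_deriv c d p v) (transition_deriv c d p w) = herm (g c p) v w)"

definition unitary_frame ::
  "('a, complex^'n) chart set \<Rightarrow> 'a set \<Rightarrow> ('a, 'n) metric \<Rightarrow> ('n \<Rightarrow> ('a, 'n) vfield) \<Rightarrow> bool" where
  "unitary_frame A W g s \<longleftrightarrow>
     (\<forall>c\<in>A. \<forall>p\<in>cdom c \<inter> W. \<forall>i j.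
        herm (g c p) (s i c p) (s j c p) = (if i = j then 1 else 0))"

definition frame_metric :: "('n::finite \<Rightarrow> ('a, 'n) vfield) \<Rightarrow> ('a, 'n) metric" where
  "frame_metric s c p = (let t = matrix_inv (frame_matrix s c p)
     in \<chi> i j. \<Sum>k\<in>UNIV. t $ i $ k * cnj (t $ j $ k))"

text \<open>The Wirtinger derivatives with respect to the \<open>j\<close>-th coordinate.\<close>

definition wirtinger :: "'n \<Rightarrow> (complex^'n \<Rightarrow> complex) \<Rightarrow> complex^'n \<Rightarrow> complex" where
  "wirtinger j f z = (frechet_derivative f (at z) (axis j 1)
     - \<i> * frechet_derivative f (at z) (axis j \<i>)) / 2"

definition wirtinger_bar :: "'n \<Rightarrow> (complex^'n \<Rightarrow> complex) \<Rightarrow> complex^'n \<Rightarrow> complex" where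
  "wirtinger_bar j f z = (frechet_derivative f (at z) (axis j 1)
     + \<i> * frechet_derivative f (at z) (axis j \<i>)) / 2"

text \<open>The coefficient of \<open>dz\<^sub>j \<and> d\<close>(conjugate of \<open>z\<^sub>k\<close>) in the Ricci form. The determinant of
  the metric is a positive real number, so \<open>ln\<close> is the usual logarithm.\<close>

definition ricci ::
  "('a, 'n) metric \<Rightarrow> ('a, complex^'n) chart \<Rightarrow> 'a \<Rightarrow> 'n \<Rightarrow> 'n::finite \<Rightarrow> complex" where
  "ricci g c p j k = \<i> / (2 * pi) *
     wirtinger j (wirtinger_bar k (\<lambda>z. ln (det (g c (chart_inv c z))))) (coord c p)"

definition ricci_flat ::
  "('a, complex^'n) chart set \<Rightarrow> 'a set \<Rightarrow> ('a, 'n) metric \<Rightarrow> bool" where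
  "ricci_flat A W g \<longleftrightarrow> (\<forall>c\<in>A. \<forall>p\<in>cdom c \<inter> W. \<forall>j k. ricci g c p j k = 0)"

text \<open>The fundamental form \<open>\<i>/2 \<Sum> g\<^sub>i\<^sub>j dz\<^sub>i \<and> d\<close>(conjugate of \<open>z\<^sub>j\<close>) as a real 2-form, and
  the exterior derivative of a 2-form in coordinates, evaluated on constant vector fields.\<close>

definition fundamental_form ::
  "('a, 'n) metric \<Rightarrow> ('a, complex^'n) chart \<Rightarrow> complex^'n \<Rightarrow> complex^'n \<Rightarrow> complex^'n::finite \<Rightarrow> real" where
  "fundamental_form g c z v w = - Im (herm (g c (chart_inv c z)) v w)"

definition ext_deriv2 ::
  "('e::real_normed_vector \<Rightarrow> 'e \<Rightarrow> 'e \<Rightarrow> real) \<Rightarrow> 'e \<Rightarrow> 'e \<Rightarrow> 'e \<Rightarrow> 'e \<Rightarrow> real" where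
  "ext_deriv2 \<omega> z u v w =
     frechet_derivative (\<lambda>x. \<omega> x v w) (at z) u
     - frechet_derivative (\<lambda>x. \<omega> x u w) (at z) v
     + frechet_derivative (\<lambda>x. \<omega> x u v) (at z) w"

definition kaehler ::
  "('a, complex^'n) chart set \<Rightarrow> 'a set \<Rightarrow> ('a, 'n) metric \<Rightarrow> bool" where
  "kaehler A W g \<longleftrightarrow> hermitian_metric A W g \<and>
     (\<forall>c\<in>A. \<forall>p\<in>cdom c \<inter> W. \<forall>u v w. ext_deriv2 (fundamental_form g c) (coord c p) u v w = 0)"

section \<open>The divisor defined by a generating set of vector fields\<close>

definition frame_divisor ::
  "'a topology \<Rightarrow> ('a, complex^'n) chart set \<Rightarrow> ('n \<Rightarrow> ('a, 'n) vfield) \<Rightarrow> 'a divisor" where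
  "frame_divisor X A s = divisor_of_zeros X A (anticanonical_bundle A) (wedge s)"

abbreviation frame_complement ::
  "'a topology \<Rightarrow> ('a, complex^'n) chart set \<Rightarrow> ('n \<Rightarrow> ('a, 'n) vfield) \<Rightarrow> 'a set" where
  "frame_complement X A s \<equiv> topspace X - divisor_support (frame_divisor X A s)"

end

theory Submission
  imports Defs "HOL-Complex_Analysis.Conformal_Mappings"
begin

text \<open>Let \<open>\<theta>\<^sub>1, \<dots>, \<theta>\<^sub>n\<close> be the coframe dual to the fields; in coordinates it is given by the
  inverse of the matrix of their components, so it is holomorphic outside the zeros of the
  wedge product, and the metric is \<open>\<Sum> \<theta>\<^sub>k \<otimes> cnj \<theta>\<^sub>k\<close>. Its determinant is the squared norm of a
  holomorphic function without zeros, whose logarithm is pluriharmonic. The exterior derivative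
  of the fundamental form vanishes iff its (2,1)-part \<open>\<Sum> d\<theta>\<^sub>k \<and> cnj \<theta>\<^sub>k\<close> does, i.e. iff all \<open>d\<theta>\<^sub>k\<close>
  vanish; and \<open>d\<theta>\<^sub>k (s\<^sub>i, s\<^sub>j) = - \<theta>\<^sub>k [s\<^sub>i, s\<^sub>j]\<close> since \<open>\<theta>\<^sub>k (s\<^sub>i)\<close> is constant. The brackets then
  vanish on the whole manifold because the wedge product is nowhere locally zero, by the identity
  theorem on the connected manifold. The same density makes quotients of local equations of the
  divisor unique, so that they glue to the isomorphism with the anticanonical bundle.\<close>

text \<open>\<open>holo_on\<close> asks for a complex-linear derivative at each point, not for its
  continuity. Yet smoothness of the metric, the second derivatives in the Ricci form and the
  holomorphy of Jacobian determinants and Lie brackets all involve derivatives of derivatives.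
  Regularity is therefore proved here: on the complex line through \<open>z\<close> in direction
  \<open>v\<close>, Cauchy's integral over a small circle expresses
  \<open>frechet_derivative f (at z) v\<close>. Circle and kernel are the same for all nearby
  \<open>z\<close>, so the formula can be differentiated under the integral sign. The other obstacle
  is division by functions that have zeros. It is replaced by cancellation: a local equation
  vanishes identically on no nonempty open set, so holomorphic functions that agree after
  multiplication by it agree everywhere. This glues units across the support of the divisor, and it
  also carries the vanishing of brackets across that support.\<close>

lemma linear_cscale_left: "linear (\<lambda>\<zeta>::complex. \<zeta> *s (v::complex^'n))"
  by (auto intro!: linearI simp: vec_eq_iff algebra_simps)

lemma bounded_linear_cscale_left: "bounded_linear (\<lambda>\<zeta>::complex. \<zeta> *s (v::complex^'n))"
  using linear_cscale_left by (simp add: linear_conv_bounded_linear)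

lemma norm_cscale: "norm (a *s (v::complex^'n)) = cmod a * norm v"
  by (simp add: norm_vec_def norm_mult L2_set_right_distrib)

subsection \<open>Holomorphic functions of several variables\<close>

text \<open>Derivatives at a point are unique, so the anonymous witness in \<open>holo_on\<close>
  can be replaced by \<open>frechet_derivative\<close>, a concrete function that can itself be
  differentiated.\<close>

lemma holo_onD:
  assumes "holo_on S f" "z \<in> S"
  shows "(f has_derivative frechet_derivative f (at z)) (at z)"
    and "frechet_derivative f (at z) (a *s v) = a * frechet_derivative f (at z) v"
proof -
  obtain D where D: "(f has_derivative D) (at z)" "\<And>a v. D (a *s v) = a * D v"
    using assms unfolding holo_on_def by blast
  have "D = frechet_derivative f (at z)" by (rule frechet_derivative_at[OF D(1)])
  with D show "(f has_derivative frechet_derivative f (at z)) (at z)"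
    "frechet_derivative f (at z) (a *s v) = a * frechet_derivative f (at z) v" by auto
qed

lemma holo_onI:
  assumes "\<And>z. z \<in> S \<Longrightarrow> (f has_derivative D z) (at z)"
    "\<And>z a v. z \<in> S \<Longrightarrow> D z (a *s v) = a * D z v"
  shows "holo_on S f"
  using assms unfolding holo_on_def by blast

lemma holo_on_imp_continuous_on:
  assumes "holo_on S f" shows "continuous_on S f"
  using holo_onD(1)[OF assms] by (intro has_derivative_continuous_on) (blast intro: has_derivative_at_withinI)

lemma holo_on_subset: "holo_on S f \<Longrightarrow> T \<subseteq> S \<Longrightarrow> holo_on T f"
  unfolding holo_on_def by blast

lemma holo_on_cong:
  assumes "holo_on S f" "open S" "\<And>z. z \<in> S \<Longrightarrow> f z = g z"
  shows "holo_on S g"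
  using assms unfolding holo_on_def by (metis has_derivative_transform_within_open)

lemma holo_on_const: "holo_on S (\<lambda>z. c)"
  by (rule holo_onI[where D="\<lambda>_ _. 0"]) auto

lemma holo_on_add:
  assumes "holo_on S f" "holo_on S g" shows "holo_on S (\<lambda>z. f z + g z)"
  by (rule holo_onI[where D="\<lambda>z v. frechet_derivative f (at z) v + frechet_derivative g (at z) v"])
     (auto intro!: derivative_eq_intros holo_onD(1) assms simp: holo_onD(2)[OF assms(1)] holo_onD(2)[OF assms(2)] algebra_simps)

lemma holo_on_mult:
  assumes "holo_on S f" "holo_on S g" shows "holo_on S (\<lambda>z. f z * g z)"
  by (rule holo_onI[where D="\<lambda>z v. f z * frechet_derivative g (at z) v + frechet_derivative f (at z) v * g z"])
     (auto intro!: derivative_eq_intros holo_onD(1)[OF assms(1)] holo_onD(1)[OF assms(2)] simp: holo_onD(2)[OF assms(1)] holo_onD(2)[OF assms(2)] algebra_simps)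

lemma holo_on_diff:
  assumes "holo_on S f" "holo_on S g" shows "holo_on S (\<lambda>z. f z - g z)"
  using holo_on_add[OF assms(1) holo_on_mult[OF holo_on_const[of S "-1"] assms(2)]] by simp

lemma holo_on_sum:
  "(\<And>i. i \<in> I \<Longrightarrow> holo_on S (f i)) \<Longrightarrow> holo_on S (\<lambda>z. \<Sum>i\<in>I. f i z)"
  by (induction I rule: infinite_finite_induct) (auto intro: holo_on_add holo_on_const)

lemma holo_on_prod:
  "(\<And>i. i \<in> I \<Longrightarrow> holo_on S (f i)) \<Longrightarrow> holo_on S (\<lambda>z. \<Prod>i\<in>I. f i z)"
  by (induction I rule: infinite_finite_induct) (auto intro: holo_on_mult holo_on_const)

lemma holo_on_inverse:
  assumes "holo_on S f" "\<And>z. z \<in> S \<Longrightarrow> f z \<noteq> 0" shows "holo_on S (\<lambda>z. inverse (f z))"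
  by (rule holo_onI[where D="\<lambda>z v. - (inverse (f z) * frechet_derivative f (at z) v * inverse (f z))"])
     (auto intro!: derivative_eq_intros holo_onD(1)[OF assms(1)] assms(2) simp: holo_onD(2)[OF assms(1)])

lemma holo_on_divide:
  assumes "holo_on S f" "holo_on S g" "\<And>z. z \<in> S \<Longrightarrow> g z \<noteq> 0" shows "holo_on S (\<lambda>z. f z / g z)"
  using holo_on_mult[OF assms(1) holo_on_inverse[OF assms(2,3)]] by (simp add: divide_inverse)

lemma holo_on_det:
  fixes M :: "complex^'n \<Rightarrow> complex^'m^'m"
  assumes "\<And>i j. holo_on S (\<lambda>z. M z $ i $ j)" shows "holo_on S (\<lambda>z. det (M z))"
  unfolding det_def by (intro holo_on_sum holo_on_mult holo_on_prod holo_on_const assms)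

text \<open>A vector is the sum of its components placed on the axes, and each placement
  \<open>axis k\<close> is bounded linear.\<close>

lemma has_derivative_vecI:
  fixes f :: "'e::real_normed_vector \<Rightarrow> complex^'n"
  assumes "\<And>k. ((\<lambda>z. f z $ k) has_derivative (\<lambda>v. D v $ k)) F"
  shows "(f has_derivative D) F"
proof -
  have bl: "bounded_linear (\<lambda>u. axis k u :: complex^'n)" for k
    by (auto simp: linear_conv_bounded_linear[symmetric] vec_eq_iff axis_def intro!: linearI)
  have "((\<lambda>z. \<Sum>k\<in>UNIV. axis k (f z $ k)) has_derivative (\<lambda>v. \<Sum>k\<in>UNIV. axis k (D v $ k))) F"
    by (intro has_derivative_sum bounded_linear.has_derivative[OF bl] assms)
  moreover have "(\<Sum>k\<in>UNIV. axis k (w $ k)) = w" for w :: "complex^'n"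
    by (simp add: vec_eq_iff axis_def)
  ultimately show ?thesis by simp
qed

lemma frechet_derivative_vec:
  fixes f :: "complex^'m \<Rightarrow> complex^'n"
  assumes "holo_vec_on S f" "z \<in> S"
  shows "(f has_derivative frechet_derivative f (at z)) (at z)"
    and "frechet_derivative f (at z) v $ k = frechet_derivative (\<lambda>z. f z $ k) (at z) v"
    and "frechet_derivative f (at z) (a *s v) = a *s frechet_derivative f (at z) v"
proof -
  have hk: "holo_on S (\<lambda>z. f z $ k)" for k using assms unfolding holo_vec_on_def by blast
  let ?D = "\<lambda>v. \<chi> k. frechet_derivative (\<lambda>z. f z $ k) (at z) v"
  have D: "(f has_derivative ?D) (at z)"
    by (rule has_derivative_vecI) (use holo_onD(1)[OF hk assms(2)] in simp)
  have eq: "?D = frechet_derivative f (at z)" by (rule frechet_derivative_at[OF D])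
  show "(f has_derivative frechet_derivative f (at z)) (at z)" using D eq by simp
  show "frechet_derivative f (at z) v $ k = frechet_derivative (\<lambda>z. f z $ k) (at z) v"
    unfolding eq[symmetric] by simp
  show "frechet_derivative f (at z) (a *s v) = a *s frechet_derivative f (at z) v"
    unfolding eq[symmetric] by (simp add: vec_eq_iff holo_onD(2)[OF hk assms(2)])
qed

lemma holo_on_compose:
  fixes f :: "complex^'m \<Rightarrow> complex^'n"
  assumes "holo_vec_on S f" "holo_on T g" "f ` S \<subseteq> T"
  shows "holo_on S (g \<circ> f)"
proof (rule holo_onI)
  fix z assume z: "z \<in> S"
  then have fz: "f z \<in> T" using assms(3) by auto
  show "(g \<circ> f has_derivative frechet_derivative g (at (f z)) \<circ> frechet_derivative f (at z)) (at z)"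
    by (rule diff_chain_at[OF frechet_derivative_vec(1)[OF assms(1) z] holo_onD(1)[OF assms(2) fz]])
  show "(frechet_derivative g (at (f z)) \<circ> frechet_derivative f (at z)) (a *s v)
      = a * (frechet_derivative g (at (f z)) \<circ> frechet_derivative f (at z)) v" for a v
    by (simp add: frechet_derivative_vec(3)[OF assms(1) z] holo_onD(2)[OF assms(2) fz])
qed

text \<open>The bridge to one complex variable: the chain rule gives a real derivative, and complex
  linearity turns it into multiplication by one complex number, the directional derivative.\<close>

lemma holo_on_line:
  fixes f :: "complex^'n \<Rightarrow> complex"
  assumes "holo_on S f" "z + \<zeta> *s v \<in> S"
  shows "((\<lambda>\<zeta>. f (z + \<zeta> *s v)) has_field_derivative frechet_derivative f (at (z + \<zeta> *s v)) v) (at \<zeta>)"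
proof -
  have "((\<lambda>\<zeta>. z + \<zeta> *s v) has_derivative (\<lambda>h. h *s v)) (at \<zeta>)"
    by (auto intro!: derivative_eq_intros bounded_linear_imp_has_derivative bounded_linear_cscale_left)
  from diff_chain_at[OF this holo_onD(1)[OF assms]]
  show ?thesis
    by (simp add: has_field_derivative_def o_def holo_onD(2)[OF assms] mult.commute[of _ "frechet_derivative f _ _"] mult_commute_abs)
qed

text \<open>The source of all higher regularity. The integral formula is used twice: for continuity
  of the directional derivatives, and then, differentiated under the integral sign, for their
  differentiability.\<close>

lemma holo_on_frechet_derivative:
  fixes f :: "complex^'n \<Rightarrow> complex"
  assumes S: "open S" and f: "holo_on S f"
  shows "holo_on S (\<lambda>z. frechet_derivative f (at z) v)"
proof -
  have local_formula: "\<exists>\<gamma> h. \<exists>e>0. continuous_on {0..1::real} \<gamma> \<and> continuous_on {0..1} h \<and>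
      (\<forall>z\<in>ball z0 e. (\<forall>t\<in>{0..1}. z + \<gamma> t *s v \<in> S) \<and>
        frechet_derivative f (at z) v = integral {0..1} (\<lambda>t. h t * f (z + \<gamma> t *s v)))"
    if z0: "z0 \<in> S" for z0 and v
  proof -
    obtain e where e: "e > 0" "ball z0 e \<subseteq> S" using S z0 openE by blast
    \<comment> \<open>Points on the circle move \<open>z\<close> by at most \<open>e / 2\<close>, so
      one radius serves all \<open>z\<close> within \<open>e / 2\<close> of \<open>z0\<close>. The
      summand 1 covers \<open>v = 0\<close>.\<close>
    define r where "r = e / (2 * (norm v + 1))"
    have r: "r > 0" unfolding r_def using e(1) by (simp add: add_nonneg_pos)
    have rv: "r * norm v \<le> e / 2"
    proof -
      have "r * norm v \<le> r * (norm v + 1)" using r by simp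
      also have "\<dots> = e / 2" unfolding r_def using norm_ge_zero[of v]
        by (simp add: field_simps add_nonneg_eq_0_iff)
      finally show ?thesis .
    qed
    have inS: "z + \<zeta> *s v \<in> S" if "z \<in> ball z0 (e/2)" "cmod \<zeta> \<le> r" for z \<zeta>
    proof -
      have "norm (\<zeta> *s v) \<le> e / 2" using that(2) rv norm_cscale[of \<zeta> v]
        by (smt (verit) mult_right_mono norm_ge_zero)
      moreover have "dist z0 z < e / 2" using that(1) by simp
      ultimately have "dist z0 (z + \<zeta> *s v) < e"
        using norm_triangle_ineq4[of "z0 - z" "\<zeta> *s v"] by (simp add: dist_norm algebra_simps)
      then show ?thesis using e(2) by auto
    qed
    define \<gamma> where "\<gamma> = circlepath 0 r"
    \<comment> \<open>The Cauchy kernel for a first derivative, velocity of the circle included; it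
      does not depend on \<open>z\<close>.\<close>
    define h where "h = (\<lambda>t. 1 / (2 * of_real pi * \<i>) * (2 * pi * \<i> * r * exp (2 * of_real pi * \<i> * of_real t) / (\<gamma> t)^2))"
    have \<gamma>0: "cmod (\<gamma> t) = r" for t
      unfolding \<gamma>_def circlepath using r by (simp add: norm_mult norm_exp_eq_Re)
    have \<gamma>nz: "\<gamma> t \<noteq> 0" for t using \<gamma>0[of t] r by auto
    have c1: "continuous_on {0..1} \<gamma>"
      unfolding \<gamma>_def circlepath by (intro continuous_intros)
    have c2: "continuous_on {0..1} h"
      unfolding h_def by (intro continuous_intros c1) (use \<gamma>nz in auto)
    have eq: "frechet_derivative f (at z) v = integral {0..1} (\<lambda>t. h t * f (z + \<gamma> t *s v))"
      if z: "z \<in> ball z0 (e/2)" for z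
    proof -
      let ?F = "\<lambda>\<zeta>. f (z + \<zeta> *s v)"
      have der: "(?F has_field_derivative frechet_derivative f (at (z + \<zeta> *s v)) v) (at \<zeta>)"
        if "cmod \<zeta> \<le> r" for \<zeta>
        by (rule holo_on_line[OF f inS[OF z that]])
      have cont: "continuous_on (cball 0 r) ?F"
        by (intro continuous_at_imp_continuous_on ballI) (simp add: DERIV_isCont[OF der])
      have hol: "?F holomorphic_on ball 0 r"
      proof (rule holomorphic_onI, rule field_differentiable_at_within)
        fix \<zeta> :: complex assume "\<zeta> \<in> ball 0 r"
        then have "(?F has_field_derivative frechet_derivative f (at (z + \<zeta> *s v)) v) (at \<zeta>)"
          by (intro der) simp
        then show "?F field_differentiable at \<zeta>"
          unfolding field_differentiable_def by (rule exI)
      qed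
      \<comment> \<open>The derivative at 0 of the restriction to the line is computed twice: by
        Cauchy's formula, and as the directional derivative of \<open>f\<close>.\<close>
      have "(?F has_field_derivative (1 / (2 * of_real pi * \<i>) * contour_integral(circlepath 0 r) (\<lambda>u. ?F u / (u-0)^2))) (at 0)"
        by (rule Cauchy_derivative_integral_circlepath(2)[OF cont hol]) (use r in simp)
      moreover have "(?F has_field_derivative frechet_derivative f (at z) v) (at 0)"
        using der[of 0] r by simp
      ultimately have "frechet_derivative f (at z) v = 1 / (2 * of_real pi * \<i>) * contour_integral(circlepath 0 r) (\<lambda>u. ?F u / (u-0)^2)"
        by (rule DERIV_unique[symmetric])
      also have "contour_integral (circlepath 0 r) (\<lambda>u. ?F u / (u-0)^2)
          = integral {0..1} (\<lambda>t. ?F (\<gamma> t) / (\<gamma> t)^2 * (2 * pi * \<i> * r * exp (2 * of_real pi * \<i> * of_real t)))"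
        by (simp only: contour_integral_integral \<gamma>_def vector_derivative_circlepath diff_zero)
      also have "1 / (2 * of_real pi * \<i>) * \<dots>
          = integral {0..1} (\<lambda>t. 1 / (2 * of_real pi * \<i>) * (?F (\<gamma> t) / (\<gamma> t)^2 * (2 * pi * \<i> * r * exp (2 * of_real pi * \<i> * of_real t))))"
        by (rule integral_mult_right[symmetric])
      also have "\<dots> = integral {0..1} (\<lambda>t. h t * f (z + \<gamma> t *s v))"
        unfolding h_def by (simp only: mult_ac times_divide_eq_left times_divide_eq_right)
      finally show ?thesis .
    qed
    have "\<forall>z\<in>ball z0 (e/2). (\<forall>t\<in>{0..1}. z + \<gamma> t *s v \<in> S) \<and>
        frechet_derivative f (at z) v = integral {0..1} (\<lambda>t. h t * f (z + \<gamma> t *s v))"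
      by (intro ballI conjI eq inS) (simp_all add: \<gamma>0)
    moreover have "e / 2 > 0" using e(1) by simp
    ultimately show ?thesis using c1 c2 by blast
  qed
  have shift: "continuous_on (U \<times> {0..1}) (\<lambda>(z, t). G (z + \<gamma> t *s w))"
    if "continuous_on {0..1::real} \<gamma>" "continuous_on S G" "\<forall>z\<in>U. \<forall>t\<in>{0..1}. z + \<gamma> t *s w \<in> S"
    for \<gamma> w and U and G :: "complex^'n \<Rightarrow> complex"
  proof -
    have "continuous_on (U \<times> {0..1}) (\<lambda>p. fst p + \<gamma> (snd p) *s w)"
      by (intro continuous_intros bounded_linear.continuous_on[OF bounded_linear_cscale_left]
          continuous_on_compose2[OF that(1)]) auto
    then have "continuous_on (U \<times> {0..1}) (\<lambda>p. G (fst p + \<gamma> (snd p) *s w))"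
      by (rule continuous_on_compose2[OF that(2)]) (use that(3) in auto)
    then show ?thesis by (simp add: case_prod_unfold)
  qed
  have weight: "continuous_on (U \<times> {0..1}) (\<lambda>(z, t). h t * g (z, t))"
    if "continuous_on {0..1::real} h" "continuous_on (U \<times> {0..1}) g" for h :: "real \<Rightarrow> complex" and g and U :: "(complex^'n) set"
  proof -
    have "continuous_on (U \<times> {0..1}) (\<lambda>p. h (snd p))"
      by (rule continuous_on_compose2[OF that(1)]) (auto intro: continuous_intros)
    then have "continuous_on (U \<times> {0..1}) (\<lambda>p. h (snd p) * g p)"
      by (intro continuous_on_mult that(2))
    then show ?thesis by (simp add: case_prod_unfold)
  qed
  \<comment> \<open>Continuity is needed in every direction \<open>w\<close>, not only in direction
    \<open>v\<close>: the derivative of the integrand below is a full linear map.\<close>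
  have cont: "continuous_on S (\<lambda>z. frechet_derivative f (at z) w)" for w
  proof (rule continuous_at_imp_continuous_on, intro ballI)
    fix z0 assume z0: "z0 \<in> S"
    obtain \<gamma> h e where e: "e > 0" and c: "continuous_on {0..1::real} \<gamma>" "continuous_on {0..1} h"
      and inS: "\<forall>z\<in>ball z0 e. \<forall>t\<in>{0..1}. z + \<gamma> t *s w \<in> S"
      and eq: "\<forall>z\<in>ball z0 e. frechet_derivative f (at z) w = integral {0..1} (\<lambda>t. h t * f (z + \<gamma> t *s w))"
      using local_formula[OF z0, of w] by blast
    have "continuous_on (ball z0 e) (\<lambda>z. integral (cbox 0 1) (\<lambda>t. h t * f (z + \<gamma> t *s w)))"
      by (rule integral_continuous_on_param)
        (use weight[OF c(2) shift[OF c(1) holo_on_imp_continuous_on[OF f] inS]] in simp)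
    then have "continuous_on (ball z0 e) (\<lambda>z. frechet_derivative f (at z) w)"
      by (rule continuous_on_eq) (use eq in simp)
    then show "isCont (\<lambda>z. frechet_derivative f (at z) w) z0"
      using e by (simp add: continuous_on_eq_continuous_at)
  qed
  show ?thesis
    unfolding holo_on_def
  proof
    fix z0 assume z0: "z0 \<in> S"
    obtain \<gamma> h e where e: "e > 0" and c: "continuous_on {0..1::real} \<gamma>" "continuous_on {0..1} h"
      and inS: "\<forall>z\<in>ball z0 e. \<forall>t\<in>{0..1}. z + \<gamma> t *s v \<in> S"
      and eq: "\<forall>z\<in>ball z0 e. frechet_derivative f (at z) v = integral {0..1} (\<lambda>t. h t * f (z + \<gamma> t *s v))"
      using local_formula[OF z0, of v] by blast
    \<comment> \<open>The Leibniz rule takes the derivative of the integrand as a jointly continuous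
      family of bounded linear maps; in finite dimension this continuity can be tested on basis
      vectors.\<close>
    define G where "G = (\<lambda>z t. Blinfun (\<lambda>w. h t * frechet_derivative f (at (z + \<gamma> t *s v)) w))"
    have G: "blinfun_apply (G z t) = (\<lambda>w. h t * frechet_derivative f (at (z + \<gamma> t *s v)) w)"
      if "z \<in> ball z0 e" "t \<in> {0..1}" for z t
      unfolding G_def
      by (rule bounded_linear_Blinfun_apply, rule bounded_linear_const_mult,
          rule has_derivative_bounded_linear[OF holo_onD(1)[OF f]]) (use inS that in auto)
    have contG: "continuous_on (ball z0 e \<times> cbox 0 1) (\<lambda>(z, t). G z t)"
    proof (rule continuous_on_blinfun_componentwise)
      fix i :: "complex^'n"
      have "continuous_on (ball z0 e \<times> {0..1}) (\<lambda>(z, t). h t * frechet_derivative f (at (z + \<gamma> t *s v)) i)"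
        using weight[OF c(2) shift[OF c(1) cont[of i] inS]] by (simp only: case_prod_conv)
      moreover have "blinfun_apply (case x of (z, t) \<Rightarrow> G z t) i
          = (case x of (z, t) \<Rightarrow> h t * frechet_derivative f (at (z + \<gamma> t *s v)) i)"
        if "x \<in> ball z0 e \<times> {0..1}" for x
        using that G by (cases x) simp
      ultimately show "continuous_on (ball z0 e \<times> cbox 0 1) (\<lambda>x. blinfun_apply (case x of (z, t) \<Rightarrow> G z t) i)"
        unfolding cbox_interval using continuous_on_cong by (metis (no_types, lifting))
    qed
    have "((\<lambda>z. integral (cbox 0 1) (\<lambda>t. h t * f (z + \<gamma> t *s v))) has_derivative integral (cbox 0 1) (G z0)) (at z0 within ball z0 e)"
    proof (rule leibniz_rule[OF _ _ contG])
      show "((\<lambda>z. h t * f (z + \<gamma> t *s v)) has_derivative blinfun_apply (G z t)) (at z within ball z0 e)"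
        if "z \<in> ball z0 e" "t \<in> cbox 0 1" for z t
      proof -
        have t: "t \<in> {0..1}" using that by simp
        have "((\<lambda>z. z + \<gamma> t *s v) has_derivative (\<lambda>w. w)) (at z)"
          by (auto intro!: derivative_eq_intros)
        moreover have "(f has_derivative frechet_derivative f (at (z + \<gamma> t *s v))) (at (z + \<gamma> t *s v))"
          using inS that(1) t by (intro holo_onD(1)[OF f]) simp
        ultimately have "(f \<circ> (\<lambda>z. z + \<gamma> t *s v) has_derivative
            frechet_derivative f (at (z + \<gamma> t *s v)) \<circ> (\<lambda>w. w)) (at z)"
          by (rule diff_chain_at)
        then have "((\<lambda>z. f (z + \<gamma> t *s v)) has_derivative frechet_derivative f (at (z + \<gamma> t *s v))) (at z)"
          by (simp add: o_def)
        then show ?thesis unfolding G[OF that(1) t]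
          by (rule has_derivative_at_withinI[OF has_derivative_mult_right])
      qed
      show "(\<lambda>t. h t * f (z + \<gamma> t *s v)) integrable_on cbox 0 1" if z: "z \<in> ball z0 e" for z
      proof (rule integrable_continuous)
        have "continuous_on {0..1} (\<lambda>t. z + \<gamma> t *s v)"
          by (intro continuous_on_add continuous_on_const bounded_linear.continuous_on[OF bounded_linear_cscale_left] c(1))
        then have "continuous_on {0..1} (\<lambda>t. f (z + \<gamma> t *s v))"
          by (rule continuous_on_compose2[OF holo_on_imp_continuous_on[OF f]]) (use inS z in auto)
        then show "continuous_on (cbox 0 1) (\<lambda>t. h t * f (z + \<gamma> t *s v))"
          unfolding cbox_interval by (intro continuous_on_mult c(2))
      qed
    qed (simp_all add: e)
    then have "((\<lambda>z. integral (cbox 0 1) (\<lambda>t. h t * f (z + \<gamma> t *s v))) has_derivative integral (cbox 0 1) (G z0)) (at z0)"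
      using at_within_open[of z0 "ball z0 e"] e by simp
    then have D: "((\<lambda>z. frechet_derivative f (at z) v) has_derivative integral (cbox 0 1) (G z0)) (at z0)"
      by (rule has_derivative_transform_within_open[where s="ball z0 e"]) (simp_all add: e eq)
    have int: "G z0 integrable_on cbox 0 1"
    proof (rule integrable_continuous)
      have "continuous_on (cbox 0 1) (\<lambda>t::real. (z0, t))"
        by (intro continuous_intros)
      from continuous_on_compose2[OF contG this] e
      show "continuous_on (cbox 0 1) (G z0)" by (simp add: image_subset_iff)
    qed
    \<comment> \<open>Complex linearity of the new derivative is inherited from the integrand, since
      scalars pass through the integral.\<close>
    have "blinfun_apply (integral (cbox 0 1) (G z0)) (a *s w) = a * blinfun_apply (integral (cbox 0 1) (G z0)) w" for a w
    proof -
      have "blinfun_apply (integral (cbox 0 1) (G z0)) (a *s w) = integral (cbox 0 1) (\<lambda>t. a * blinfun_apply (G z0 t) w)"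
        unfolding blinfun_apply_integral[OF int]
      proof (rule integral_cong)
        fix t :: real assume "t \<in> cbox 0 1"
        then have t: "t \<in> {0..1}" and z: "z0 \<in> ball z0 e" using e by auto
        then show "blinfun_apply (G z0 t) (a *s w) = a * blinfun_apply (G z0 t) w"
          unfolding G[OF z t] using holo_onD(2)[OF f, of "z0 + \<gamma> t *s v" a w] inS by simp
      qed
      then show ?thesis unfolding blinfun_apply_integral[OF int] by simp
    qed
    with D show "\<exists>D. ((\<lambda>z. frechet_derivative f (at z) v) has_derivative D) (at z0) \<and> (\<forall>a v. D (a *s v) = a * D v)"
      by blast
  qed
qed

subsection \<open>Smoothness\<close>

text \<open>Both functions have the same set of derivatives at \<open>x\<close>, so the choice
  operator picks the same one; differentiability is not assumed.\<close>

lemma frechet_derivative_cong: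
  assumes "open S" "x \<in> S" "\<And>y. y \<in> S \<Longrightarrow> f y = g y"
  shows "frechet_derivative f (at x) = frechet_derivative g (at x)"
proof -
  have "(g has_derivative D) (at x)" if "(f has_derivative D) (at x)" for D
    by (rule has_derivative_transform_within_open[OF that assms(1,2)]) (rule assms(3))
  moreover have "(f has_derivative D) (at x)" if "(g has_derivative D) (at x)" for D
    by (rule has_derivative_transform_within_open[OF that assms(1,2)]) (rule assms(3)[symmetric])
  ultimately have "(f has_derivative D) (at x) \<longleftrightarrow> (g has_derivative D) (at x)" for D
    by blast
  then show ?thesis unfolding frechet_derivative_def by simp
qed

lemma Ck_on_cong:
  assumes "Ck_on k S f" "open S" "\<And>x. x \<in> S \<Longrightarrow> f x = g x"
  shows "Ck_on k S g"
  using assms(1,3)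
proof (induction k arbitrary: f g)
  case 0
  then show ?case unfolding Ck_on.simps(1) by (rule continuous_on_eq)
next
  case (Suc k)
  have "g differentiable at x" if x: "x \<in> S" for x
  proof -
    obtain D where "(f has_derivative D) (at x)"
      using Suc.prems(1) x unfolding Ck_on.simps differentiable_def by blast
    then have "(g has_derivative D) (at x)"
      by (rule has_derivative_transform_within_open[OF _ assms(2) x]) (rule Suc.prems(2))
    then show ?thesis unfolding differentiable_def by blast
  qed
  moreover have "Ck_on k S (\<lambda>x. frechet_derivative g (at x) v)" for v
  proof (rule Suc.IH)
    show "Ck_on k S (\<lambda>x. frechet_derivative f (at x) v)" using Suc.prems(1) by simp
    show "frechet_derivative f (at x) v = frechet_derivative g (at x) v" if "x \<in> S" for x
      using frechet_derivative_cong[OF assms(2) that, of f g] Suc.prems(2) by simp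
  qed
  ultimately show ?case by simp
qed

text \<open>The product rule leaves undifferentiated factors, known to be of class
  \<open>Suc k\<close>, where class \<open>k\<close> is required.\<close>

lemma Ck_on_Suc_imp_Ck_on: "Ck_on (Suc k) S f \<Longrightarrow> Ck_on k S f"
proof (induction k arbitrary: f)
  case 0
  then show ?case
    by (auto intro!: differentiable_imp_continuous_on simp: differentiable_on_def differentiable_at_withinI)
next
  case (Suc k)
  then show ?case using Ck_on.simps(2) by blast
qed

text \<open>Allows the derivative to be given by an explicit formula \<open>D\<close> in the
  inductions on \<open>k\<close>.\<close>

lemma Ck_on_Suc_I:
  assumes "open S" "\<And>x. x \<in> S \<Longrightarrow> (f has_derivative D x) (at x)" "\<And>v. Ck_on k S (\<lambda>x. D x v)"
  shows "Ck_on (Suc k) S f"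
proof -
  have "D x = frechet_derivative f (at x)" if "x \<in> S" for x
    by (rule frechet_derivative_at[OF assms(2)[OF that]])
  then have "Ck_on k S (\<lambda>x. frechet_derivative f (at x) v)" for v
    by (intro Ck_on_cong[OF assms(3)[of v] assms(1)]) simp
  then show ?thesis using assms(2) by (auto simp: differentiable_def)
qed

lemma Ck_on_SucD:
  assumes "Ck_on (Suc k) S f" "x \<in> S"
  shows "(f has_derivative frechet_derivative f (at x)) (at x)"
  using assms by (auto simp: frechet_derivative_works)

lemma Ck_on_const: "open S \<Longrightarrow> Ck_on k S (\<lambda>x. c)"
proof (induction k arbitrary: c)
  case (Suc k)
  then show ?case by (intro Ck_on_Suc_I[where D="\<lambda>_ _. 0"]) auto
qed auto

lemma Ck_on_add:
  assumes "open S"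
  shows "Ck_on k S f \<Longrightarrow> Ck_on k S g \<Longrightarrow> Ck_on k S (\<lambda>x. f x + g x)"
proof (induction k arbitrary: f g)
  case (Suc k)
  show ?case
    by (rule Ck_on_Suc_I[where D="\<lambda>x v. frechet_derivative f (at x) v + frechet_derivative g (at x) v"])
       (use Suc assms in \<open>auto intro!: has_derivative_add simp: frechet_derivative_works\<close>)
qed (auto intro: continuous_intros)

lemma Ck_on_sum:
  "open S \<Longrightarrow> (\<And>i. i \<in> I \<Longrightarrow> Ck_on k S (f i)) \<Longrightarrow> Ck_on k S (\<lambda>x. \<Sum>i\<in>I. f i x)"
  by (induction I rule: infinite_finite_induct) (auto intro: Ck_on_add Ck_on_const)

lemma Ck_on_mult:
  fixes f g :: "_ \<Rightarrow> 'f::real_normed_algebra"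
  assumes "open S"
  shows "Ck_on k S f \<Longrightarrow> Ck_on k S g \<Longrightarrow> Ck_on k S (\<lambda>x. f x * g x)"
proof (induction k arbitrary: f g)
  case (Suc k)
  show ?case
  proof (rule Ck_on_Suc_I[where D="\<lambda>x v. f x * frechet_derivative g (at x) v + frechet_derivative f (at x) v * g x", OF assms])
    show "((\<lambda>x. f x * g x) has_derivative (\<lambda>v. f x * frechet_derivative g (at x) v + frechet_derivative f (at x) v * g x)) (at x)"
      if "x \<in> S" for x
      by (intro has_derivative_mult Ck_on_SucD[OF Suc.prems(1) that] Ck_on_SucD[OF Suc.prems(2) that])
    show "Ck_on k S (\<lambda>x. f x * frechet_derivative g (at x) v + frechet_derivative f (at x) v * g x)" for v
      by (intro Ck_on_add[OF assms] Suc.IH Ck_on_Suc_imp_Ck_on[OF Suc.prems(1)] Ck_on_Suc_imp_Ck_on[OF Suc.prems(2)])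
         (use Suc.prems in auto)
  qed
qed (auto intro: continuous_intros)

lemma Ck_on_bounded_linear:
  assumes "open S" "bounded_linear L"
  shows "Ck_on k S f \<Longrightarrow> Ck_on k S (\<lambda>x. L (f x))"
proof (induction k arbitrary: f)
  case 0
  then show ?case by (auto intro: bounded_linear.continuous_on[OF assms(2)])
next
  case (Suc k)
  show ?case
    by (rule Ck_on_Suc_I[where D="\<lambda>x v. L (frechet_derivative f (at x) v)", OF assms(1)])
       (use Suc in \<open>auto intro!: bounded_linear.has_derivative[OF assms(2)] simp: frechet_derivative_works\<close>)
qed

lemma holo_on_imp_Ck_on: "open S \<Longrightarrow> holo_on S f \<Longrightarrow> Ck_on k S f"
proof (induction k arbitrary: f)
  case 0
  then show ?case by (simp add: holo_on_imp_continuous_on)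
next
  case (Suc k)
  then show ?case
    by (intro Ck_on_Suc_I[where D="\<lambda>x. frechet_derivative f (at x)"])
       (auto intro: holo_onD(1) holo_on_frechet_derivative)
qed

subsection \<open>The identity theorem\<close>

text \<open>Reduction to one variable: join \<open>x\<close> to a point \<open>q\<close> of
  \<open>U\<close> by a complex line. The part of the line inside the convex set \<open>B\<close> is
  convex, hence connected, and the part inside \<open>U\<close> is open and nonempty, so analytic
  continuation applies.\<close>

lemma holo_on_zero_propagates:
  fixes f :: "complex^'n \<Rightarrow> complex"
  assumes f: "holo_on B f" and B: "open B" "convex B"
    and U: "open U" "U \<subseteq> B" "U \<noteq> {}" "\<And>z. z \<in> U \<Longrightarrow> f z = 0" and x: "x \<in> B"
  shows "f x = 0"
proof -
  obtain q where q: "q \<in> U" using U by auto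
  define v where "v = x - q"
  let ?l = "\<lambda>\<zeta>::complex. q + \<zeta> *s v"
  have l: "continuous_on UNIV ?l"
    by (intro continuous_intros bounded_linear.continuous_on[OF bounded_linear_cscale_left])
  have "open (?l -` B)" and oU: "open (?l -` U)"
    using open_vimage[OF _ l] B(1) U(1) by auto
  moreover have "convex (?l -` B)"
  proof (rule convexI)
    fix a b :: complex and s t :: real
    assume *: "a \<in> ?l -` B" "b \<in> ?l -` B" "0 \<le> s" "0 \<le> t" "s + t = 1"
    have "q = s *\<^sub>R q + t *\<^sub>R q" using *(5) by (metis scaleR_left_distrib scaleR_one)
    then have "?l (s *\<^sub>R a + t *\<^sub>R b) = s *\<^sub>R ?l a + t *\<^sub>R ?l b"
      by (simp add: vec_eq_iff algebra_simps) 
    moreover have "s *\<^sub>R ?l a + t *\<^sub>R ?l b \<in> B"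
      using * B(2) by (auto intro: convexD)
    ultimately show "s *\<^sub>R a + t *\<^sub>R b \<in> ?l -` B" by simp
  qed
  moreover have "(\<lambda>\<zeta>. f (?l \<zeta>)) holomorphic_on ?l -` B"
  proof (rule holomorphic_onI, rule field_differentiable_at_within)
    fix \<zeta> assume "\<zeta> \<in> ?l -` B"
    then have "((\<lambda>\<zeta>. f (?l \<zeta>)) has_field_derivative frechet_derivative f (at (?l \<zeta>)) v) (at \<zeta>)"
      by (intro holo_on_line[OF f]) simp
    then show "(\<lambda>\<zeta>. f (?l \<zeta>)) field_differentiable at \<zeta>"
      unfolding field_differentiable_def by (rule exI)
  qed
  moreover have "?l -` U \<noteq> {}"
  proof -
    have "0 \<in> ?l -` U" using q by simp
    then show ?thesis by blast
  qed
  moreover have "1 \<in> ?l -` B" using x by (simp add: v_def)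
  ultimately have "f (?l 1) = 0"
    using U(2,4) by (intro analytic_continuation_open[of "?l -` U" "?l -` B" "\<lambda>\<zeta>. f (?l \<zeta>)" "\<lambda>_. 0" 1])
      (auto intro: convex_connected)
  then show ?thesis unfolding v_def by simp
qed

subsection \<open>Matrices\<close>

lemma matrix_inv_right:
  fixes M :: "'a::field^'n^'n"
  assumes "det M \<noteq> 0" shows "M ** matrix_inv M = mat 1"
  using assms someI_ex[of "\<lambda>N. M ** N = mat 1 \<and> N ** M = mat 1"]
  unfolding invertible_det_nz[symmetric] invertible_def matrix_inv_def by blast

lemma matrix_inv_left:
  fixes M :: "'a::field^'n^'n"
  assumes "det M \<noteq> 0" shows "matrix_inv M ** M = mat 1"
  using matrix_inv_right[OF assms] matrix_left_right_inverse by blast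

text \<open>Cramer's rule for the \<open>j\<close>-th column of the inverse. It shows the entries to
  be quotients of polynomials in the entries of \<open>M\<close>, which is how holomorphy passes to
  the inverse.\<close>

lemma matrix_inv_entry:
  fixes M :: "'a::field^'n^'n"
  assumes "det M \<noteq> 0"
  shows "matrix_inv M $ i $ j = det (\<chi> k l. if l = i then axis j 1 $ k else M $ k $ l) / det M"
proof -
  have "M *v (matrix_inv M *v axis j 1) = axis j 1"
    by (simp add: matrix_vector_mul_assoc matrix_inv_right[OF assms])
  then have "matrix_inv M *v axis j 1 = (\<chi> i. det (\<chi> k l. if l = i then axis j 1 $ k else M $ k $ l) / det M)"
    using cramer[OF assms] by blast
  then have "(matrix_inv M *v axis j 1) $ i = det (\<chi> k l. if l = i then axis j 1 $ k else M $ k $ l) / det M"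
    by simp
  moreover have "(matrix_inv M *v axis j 1) $ i = matrix_inv M $ i $ j"
    by (simp add: matrix_vector_mult_def axis_def if_distrib cong: if_cong)
  ultimately show ?thesis by simp
qed

lemma holo_on_matrix_inv:
  fixes M :: "complex^'n \<Rightarrow> complex^'m^'m"
  assumes "open S" "\<And>i j. holo_on S (\<lambda>z. M z $ i $ j)" "\<And>z. z \<in> S \<Longrightarrow> det (M z) \<noteq> 0"
  shows "holo_on S (\<lambda>z. matrix_inv (M z) $ i $ j)"
proof (rule holo_on_cong[OF _ assms(1)])
  have "holo_on S (\<lambda>z. (\<chi> k l. if l = i then axis j 1 $ k else M z $ k $ l) $ k $ l)" for k l
    by (cases "l = i") (auto intro: holo_on_const assms(2))
  then show "holo_on S (\<lambda>z. det (\<chi> k l. if l = i then axis j 1 $ k else M z $ k $ l) / det (M z))"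
    by (intro holo_on_divide holo_on_det assms(2,3))
qed (simp add: matrix_inv_entry[OF assms(3)])

subsection \<open>The hermitian form with prescribed unitary basis\<close>

lemma sum_swap3:
  "(\<Sum>k\<in>K. \<Sum>l\<in>L. \<Sum>i\<in>I. F i k l) = (\<Sum>i\<in>I. \<Sum>k\<in>K. \<Sum>l\<in>L. F i k l)"
proof -
  have "(\<Sum>l\<in>L. \<Sum>i\<in>I. F i k l) = (\<Sum>i\<in>I. \<Sum>l\<in>L. F i k l)" for k by (rule sum.swap)
  then show ?thesis by (simp only: sum.swap[of _ K I])
qed

lemma herm_sum_left: "herm G (\<Sum>i\<in>I. a i *s f i) w = (\<Sum>i\<in>I. a i * herm G (f i) w)"
proof -
  have "herm G (\<Sum>i\<in>I. a i *s f i) w = (\<Sum>k\<in>UNIV. \<Sum>l\<in>UNIV. \<Sum>i\<in>I. a i * (G $ k $ l * f i $ k * cnj (w $ l)))"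
    unfolding herm_def by (simp add: sum_distrib_left sum_distrib_right mult_ac)
  also have "\<dots> = (\<Sum>i\<in>I. a i * herm G (f i) w)"
    unfolding herm_def sum_distrib_left by (rule sum_swap3)
  finally show ?thesis .
qed

lemma herm_sum_right: "herm G v (\<Sum>i\<in>I. a i *s f i) = (\<Sum>i\<in>I. cnj (a i) * herm G v (f i))"
proof -
  have "herm G v (\<Sum>i\<in>I. a i *s f i) = (\<Sum>k\<in>UNIV. \<Sum>l\<in>UNIV. \<Sum>i\<in>I. cnj (a i) * (G $ k $ l * v $ k * cnj (f i $ l)))"
    unfolding herm_def by (simp add: sum_distrib_left sum_distrib_right mult_ac)
  also have "\<dots> = (\<Sum>i\<in>I. cnj (a i) * herm G v (f i))"
    unfolding herm_def sum_distrib_left by (rule sum_swap3)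
  finally show ?thesis .
qed

lemma herm_axis: "herm G (axis i 1) (axis j 1) = G $ i $ j"
proof -
  have "herm G (axis i 1) (axis j 1) = (\<Sum>k\<in>UNIV. \<Sum>l\<in>UNIV. if l = j then (if k = i then G $ k $ l else 0) else 0)"
    unfolding herm_def axis_def by (intro sum.cong refl) auto
  then show ?thesis by simp
qed

text \<open>The frame vectors are the rows of \<open>M\<close>, so the coordinates of
  \<open>v\<close> in the frame come from a row-vector product. Component \<open>k\<close> is the
  dual form \<theta> of index \<open>k\<close> at \<open>v\<close>.\<close>

definition coframe :: "complex^'n^'n \<Rightarrow> complex^'n \<Rightarrow> complex^'n" where
  "coframe M v = v v* matrix_inv M"

text \<open>The entries of \<open>frame_metric\<close> as a function of the matrix alone, so that
  the linear algebra is free of charts and points.\<close>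

definition frame_form :: "complex^'n^'n \<Rightarrow> complex^'n^'n" where
  "frame_form M = (\<chi> i j. \<Sum>k\<in>UNIV. matrix_inv M $ i $ k * cnj (matrix_inv M $ j $ k))"

lemma coframe_nth: "coframe M v $ k = (\<Sum>i\<in>UNIV. v $ i * matrix_inv M $ i $ k)"
  by (simp add: coframe_def vector_matrix_mult_def mult.commute)

lemma coframe_add: "coframe M (v + w) = coframe M v + coframe M w"
  and coframe_diff: "coframe M (v - w) = coframe M v - coframe M w"
  and coframe_cscale: "coframe M (a *s v) = a *s coframe M v"
  by (simp_all add: vec_eq_iff coframe_nth algebra_simps sum.distrib sum_subtractf sum_distrib_left)

lemma coframe_sum: "coframe M (\<Sum>i\<in>I. f i) = (\<Sum>i\<in>I. coframe M (f i))"
  by (induction I rule: infinite_finite_induct)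
     (auto simp: coframe_add, simp_all add: vec_eq_iff coframe_nth)

lemma coframe_row:
  assumes "det M \<noteq> 0" shows "coframe M (M $ i) = axis i 1"
proof -
  have "coframe M (M $ i) $ k = (M ** matrix_inv M) $ i $ k" for k
    by (simp add: coframe_nth matrix_matrix_mult_def)
  then show ?thesis by (simp add: vec_eq_iff matrix_inv_right[OF assms] mat_def axis_def)
qed

lemma coframe_expand:
  assumes "det M \<noteq> 0" shows "(\<Sum>i\<in>UNIV. coframe M v $ i *s M $ i) = v"
proof -
  have "(\<Sum>i\<in>UNIV. coframe M v $ i *s M $ i) = coframe M v v* M"
    by (simp add: vec_eq_iff vector_matrix_mult_def mult.commute)
  also have "\<dots> = v"
    unfolding coframe_def by (simp add: vector_matrix_mul_assoc matrix_inv_left[OF assms])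
  finally show ?thesis .
qed

text \<open>Interchanging sums makes the form a standard hermitian product of coframe coordinates;
  unitarity, positivity, invariance and the exterior derivative are all read off from this.\<close>

lemma herm_frame_form:
  "herm (frame_form M) v w = (\<Sum>k\<in>UNIV. coframe M v $ k * cnj (coframe M w $ k))"
proof -
  have "(\<Sum>k\<in>UNIV. coframe M v $ k * cnj (coframe M w $ k))
     = (\<Sum>k\<in>UNIV. \<Sum>i\<in>UNIV. \<Sum>j\<in>UNIV. matrix_inv M $ i $ k * cnj (matrix_inv M $ j $ k) * v $ i * cnj (w $ j))"
    by (simp add: coframe_nth sum_product mult_ac)
  also have "\<dots> = (\<Sum>i\<in>UNIV. \<Sum>j\<in>UNIV. \<Sum>k\<in>UNIV. matrix_inv M $ i $ k * cnj (matrix_inv M $ j $ k) * v $ i * cnj (w $ j))"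
    by (subst sum.swap, rule sum.cong[OF refl], rule sum.swap)
  also have "\<dots> = herm (frame_form M) v w"
    by (simp add: herm_def frame_form_def sum_distrib_right)
  finally show ?thesis by simp
qed

lemma herm_frame_form_rows:
  assumes "det M \<noteq> 0"
  shows "herm (frame_form M) (M $ i) (M $ j) = (if i = j then 1 else 0)"
proof -
  have "(\<Sum>k\<in>UNIV. axis i 1 $ k * cnj (axis j 1 $ k)) = (\<Sum>k\<in>UNIV. if k = i then (if i = j then 1 else 0) else (0::complex))"
    unfolding axis_def by (intro sum.cong refl) auto
  then show ?thesis unfolding herm_frame_form coframe_row[OF assms] by simp
qed

text \<open>A sesquilinear form is determined by its values on a basis, and its matrix by its values
  on the axes.\<close>

lemma herm_frame_form_unique:
  assumes M: "det M \<noteq> 0" and H: "\<And>i j. herm H (M $ i) (M $ j) = (if i = j then 1 else 0)"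
  shows "H = frame_form M"
proof -
  have eq: "herm H v w = herm (frame_form M) v w" for v w
  proof -
    have "herm H v w = herm H (\<Sum>i\<in>UNIV. coframe M v $ i *s M $ i) (\<Sum>j\<in>UNIV. coframe M w $ j *s M $ j)"
      by (simp only: coframe_expand[OF M])
    also have "\<dots> = (\<Sum>i\<in>UNIV. coframe M v $ i * (\<Sum>j\<in>UNIV. cnj (coframe M w $ j) * (if i = j then 1 else 0)))"
      by (subst herm_sum_left) (simp only: herm_sum_right H)
    also have "\<dots> = herm (frame_form M) v w"
      unfolding herm_frame_form by (simp add: if_distrib cong: if_cong)
    finally show ?thesis .
  qed
  then show ?thesis by (simp add: vec_eq_iff herm_axis[symmetric])
qed

lemma frame_form_positive:
  assumes M: "det M \<noteq> 0" and v: "v \<noteq> 0"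
  shows "0 < Re (herm (frame_form M) v v)"
proof -
  have "coframe M v \<noteq> 0" using coframe_expand[OF M, of v] v by auto
  then obtain k where "coframe M v $ k \<noteq> 0" by (auto simp: vec_eq_iff)
  then have "0 < (\<Sum>k\<in>UNIV. (cmod (coframe M v $ k))\<^sup>2)"
    by (intro sum_pos2[of _ k]) auto
  moreover have "Re (herm (frame_form M) v v) = (\<Sum>k\<in>UNIV. (cmod (coframe M v $ k))\<^sup>2)"
    unfolding herm_frame_form by (simp add: cmod_power2) (simp add: power2_eq_square)
  ultimately show ?thesis by simp
qed

lemma herm_frame_form_sym: "herm (frame_form M) w v = cnj (herm (frame_form M) v w)"
  by (simp add: herm_frame_form mult.commute)

text \<open>The matrix of the form is the inverse of \<open>M\<close> times its own conjugate
  transpose.\<close>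

lemma det_frame_form:
  "det (frame_form M) = det (matrix_inv M) * cnj (det (matrix_inv M))"
proof -
  let ?t = "matrix_inv M"
  have "det (frame_form M) = det (?t ** transpose (\<chi> i j. cnj (?t $ i $ j)))"
    by (rule arg_cong[where f=det]) (simp add: vec_eq_iff frame_form_def matrix_matrix_mult_def transpose_def)
  also have "\<dots> = det ?t * det (\<chi> i j. cnj (?t $ i $ j))" by (simp add: det_mul det_transpose)
  also have "det (\<chi> i j. cnj (?t $ i $ j)) = cnj (det ?t)"
    by (simp add: det_def)
  finally show ?thesis .
qed

subsection \<open>Charts\<close>

lemma holo_on_localI:
  "(\<And>z. z \<in> S \<Longrightarrow> \<exists>T. z \<in> T \<and> holo_on T f) \<Longrightarrow> holo_on S f"
  unfolding holo_on_def by blast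

text \<open>\<open>matrix T\<close> records \<open>T\<close> only on the vectors
  \<open>axis i 1\<close>, which span over the complex numbers but not over the reals; hence
  commutation with complex scalars is required besides \<open>linear T\<close>.\<close>

lemma matrix_of_complex_linear:
  fixes T :: "complex^'n \<Rightarrow> complex^'m"
  assumes "linear T" "\<And>a v. T (a *s v) = a *s T v"
  shows "matrix T *v v = T v"
proof -
  have "T v = T (\<Sum>i\<in>UNIV. v $ i *s axis i 1)" by (simp add: basis_expansion)
  also have "\<dots> = (\<Sum>i\<in>UNIV. v $ i *s T (axis i 1))" by (simp add: linear_sum[OF assms(1)] assms(2))
  finally show ?thesis by (simp add: vec_eq_iff matrix_vector_mult_def matrix_def mult.commute)
qed

locale complex_atlas =
  fixes X :: "'a topology" and A :: "('a, complex^'n) chart set"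
  assumes atlas: "is_atlas holo_vec_on X A"
begin

section \<open>Topology of charts and derivatives of transition maps\<close>

lemma chart: "c \<in> A \<Longrightarrow> is_chart X c"
  using atlas unfolding is_atlas_def by blast

lemma openin_cdom: "c \<in> A \<Longrightarrow> openin X (cdom c)"
  using chart unfolding is_chart_def by blast

lemma topspace_chart: "c \<in> A \<Longrightarrow> topspace (subtopology X (cdom c)) = cdom c"
  using openin_subset[OF openin_cdom[of c]] by auto

lemma chart_at: "p \<in> topspace X \<Longrightarrow> \<exists>c\<in>A. p \<in> cdom c"
  using atlas unfolding is_atlas_def by blast

lemma inj_on_coord:
  assumes "c \<in> A" shows "inj_on (coord c) (cdom c)"
  using homeomorphic_imp_injective_map[of "subtopology X (cdom c)" _ "coord c"]
    chart[OF assms] topspace_chart[OF assms] unfolding is_chart_def by metis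

lemma chart_inv_coord: "c \<in> A \<Longrightarrow> p \<in> cdom c \<Longrightarrow> chart_inv c (coord c p) = p"
  unfolding chart_inv_def using inj_on_coord by simp

lemma open_coord_image:
  assumes c: "c \<in> A" and U: "openin X U"
  shows "open (coord c ` (cdom c \<inter> U))"
proof -
  have "open_map (subtopology X (cdom c)) (top_of_set (coord c ` cdom c)) (coord c)"
    using chart[OF c] homeomorphic_imp_open_map unfolding is_chart_def by blast
  moreover have "openin (subtopology X (cdom c)) (cdom c \<inter> U)"
    by (simp add: U openin_subtopology_Int2)
  ultimately have "openin (top_of_set (coord c ` cdom c)) (coord c ` (cdom c \<inter> U))"
    unfolding open_map_def by blast
  then show ?thesis
    using chart[OF c] openin_open_eq unfolding is_chart_def by blast
qed

lemma open_coord_image':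
  assumes "c \<in> A" "openin X U" "U \<subseteq> cdom c" shows "open (coord c ` U)"
  using open_coord_image[OF assms(1,2)] assms(3) by (simp add: Int_absorb1)

lemma openin_coord_preimage:
  assumes c: "c \<in> A" and V: "open V"
  shows "openin X {p \<in> cdom c. coord c p \<in> V}"
proof -
  have "continuous_map (subtopology X (cdom c)) (top_of_set (coord c ` cdom c)) (coord c)"
    using chart[OF c] homeomorphic_imp_continuous_map unfolding is_chart_def by blast
  moreover have "openin (top_of_set (coord c ` cdom c)) (coord c ` cdom c \<inter> V)"
    using V by (simp add: openin_open_Int)
  ultimately have "openin (subtopology X (cdom c)) {p \<in> topspace (subtopology X (cdom c)). coord c p \<in> coord c ` cdom c \<inter> V}"
    by (rule openin_continuous_map_preimage)
  moreover have "{p \<in> topspace (subtopology X (cdom c)). coord c p \<in> coord c ` cdom c \<inter> V} = {p \<in> cdom c. coord c p \<in> V}"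
    using topspace_chart[OF c] by auto
  ultimately show ?thesis
    using openin_open_subtopology[OF openin_cdom[OF c]] by auto
qed

lemma holo_transition:
  assumes "c \<in> A" "d \<in> A"
  shows "holo_vec_on (coord c ` (cdom c \<inter> cdom d)) (transition c d)"
  using atlas assms unfolding is_atlas_def by blast

lemma transition_coord: "c \<in> A \<Longrightarrow> p \<in> cdom c \<Longrightarrow> transition c d (coord c p) = coord d p"
  by (simp add: transition_def chart_inv_coord)

lemma transition_deriv_linear:
  assumes "c \<in> A" "d \<in> A" "p \<in> cdom c" "p \<in> cdom d"
  shows "linear (transition_deriv c d p)"
    and "transition_deriv c d p (a *s v) = a *s transition_deriv c d p v"
    and "matrix (transition_deriv c d p) *v v = transition_deriv c d p v"
proof -
  have z: "coord c p \<in> coord c ` (cdom c \<inter> cdom d)" using assms by blast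
  show lin: "linear (transition_deriv c d p)"
    unfolding transition_deriv_def
    by (rule has_derivative_linear[OF frechet_derivative_vec(1)[OF holo_transition[OF assms(1,2)] z]])
  show cs: "transition_deriv c d p (a *s v) = a *s transition_deriv c d p v" for a v
    unfolding transition_deriv_def by (rule frechet_derivative_vec(3)[OF holo_transition[OF assms(1,2)] z])
  show "matrix (transition_deriv c d p) *v v = transition_deriv c d p v"
    by (rule matrix_of_complex_linear[OF lin cs])
qed

subsection \<open>Holomorphic functions\<close>

lemma holo_fun_subset: "holo_fun A U f \<Longrightarrow> V \<subseteq> U \<Longrightarrow> holo_fun A V f"
  unfolding holo_fun_def by (metis holo_on_subset image_mono inf_mono order_refl)

text \<open>\<open>holo_on\<close> is a condition at each point that already refers to full
  neighbourhoods, so the sets \<open>V\<close> may be arbitrary sets containing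
  \<open>p\<close>.\<close>

lemma holo_fun_localI:
  assumes "\<And>p. p \<in> U \<Longrightarrow> \<exists>V. p \<in> V \<and> holo_fun A V f"
  shows "holo_fun A U f"
  unfolding holo_fun_def
proof
  fix c assume c: "c \<in> A"
  show "holo_on (coord c ` (cdom c \<inter> U)) (f \<circ> chart_inv c)"
  proof (rule holo_on_localI)
    fix z assume "z \<in> coord c ` (cdom c \<inter> U)"
    then obtain p where p: "p \<in> cdom c" "p \<in> U" "z = coord c p" by blast
    obtain V where V: "p \<in> V" "holo_fun A V f" using assms[OF p(2)] by blast
    have "z \<in> coord c ` (cdom c \<inter> V)" using p V(1) by simp
    moreover have "holo_on (coord c ` (cdom c \<inter> V)) (f \<circ> chart_inv c)"
      using V(2) c unfolding holo_fun_def by (rule bspec)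
    ultimately show "\<exists>T. z \<in> T \<and> holo_on T (f \<circ> chart_inv c)" by (intro exI conjI)
  qed
qed

text \<open>One chart suffices: the expression in any other chart differs by composition with a
  holomorphic transition map.\<close>

lemma holo_fun_chartI:
  assumes c: "c \<in> A" and U: "openin X U" "U \<subseteq> cdom c"
    and f: "holo_on (coord c ` U) (f \<circ> chart_inv c)"
  shows "holo_fun A U f"
  unfolding holo_fun_def
proof
  fix d assume d: "d \<in> A"
  let ?S = "coord d ` (cdom d \<inter> U)"
  have "holo_vec_on ?S (transition d c)"
    using holo_transition[OF d c] U(2) holo_on_subset[of "coord d ` (cdom d \<inter> cdom c)"]
    unfolding holo_vec_on_def by (metis image_mono inf_mono order_refl)
  moreover have "transition d c ` ?S \<subseteq> coord c ` U"
    using transition_coord[OF d, of _ c] by auto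
  ultimately have "holo_on ?S ((f \<circ> chart_inv c) \<circ> transition d c)"
    using f holo_on_compose by blast
  then show "holo_on ?S (f \<circ> chart_inv d)"
  proof (rule holo_on_cong)
    show "open ?S" by (rule open_coord_image[OF d U(1)])
    fix z assume "z \<in> ?S"
    then show "((f \<circ> chart_inv c) \<circ> transition d c) z = (f \<circ> chart_inv d) z"
      using transition_coord[OF d, of _ c] chart_inv_coord[OF c] chart_inv_coord[OF d] U(2) by auto
  qed
qed

lemma holo_fun_cong:
  assumes "holo_fun A U f" "openin X U" "\<And>p. p \<in> U \<Longrightarrow> f p = g p"
  shows "holo_fun A U g"
  unfolding holo_fun_def
proof
  fix c assume c: "c \<in> A"
  then have "holo_on (coord c ` (cdom c \<inter> U)) (f \<circ> chart_inv c)"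
    using assms(1) unfolding holo_fun_def by blast
  then show "holo_on (coord c ` (cdom c \<inter> U)) (g \<circ> chart_inv c)"
    by (rule holo_on_cong[OF _ open_coord_image[OF c assms(2)]])
       (use chart_inv_coord[OF c] assms(3) in auto)
qed

lemma holo_fun_mult: "holo_fun A U f \<Longrightarrow> holo_fun A U g \<Longrightarrow> holo_fun A U (\<lambda>p. f p * g p)"
  unfolding holo_fun_def o_def by (intro ballI holo_on_mult) blast+

lemma holo_fun_diff: "holo_fun A U f \<Longrightarrow> holo_fun A U g \<Longrightarrow> holo_fun A U (\<lambda>p. f p - g p)"
  unfolding holo_fun_def o_def by (intro ballI holo_on_diff) blast+

lemma holo_fun_inverse:
  assumes "holo_fun A U f" "\<And>p. p \<in> U \<Longrightarrow> f p \<noteq> 0"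
  shows "holo_fun A U (\<lambda>p. inverse (f p))"
  unfolding holo_fun_def o_def
proof
  fix c assume c: "c \<in> A"
  show "holo_on (coord c ` (cdom c \<inter> U)) (\<lambda>z. inverse (f (chart_inv c z)))"
    by (rule holo_on_inverse)
      (use assms c chart_inv_coord[OF c] in \<open>auto simp: holo_fun_def o_def\<close>)
qed

lemma holo_fun_det:
  fixes M :: "'a \<Rightarrow> complex^'m^'m"
  assumes "\<And>i j. holo_fun A U (\<lambda>p. M p $ i $ j)" shows "holo_fun A U (\<lambda>p. det (M p))"
  using assms unfolding holo_fun_def o_def by (intro ballI holo_on_det) blast

lemma openin_nonzero:
  assumes U: "openin X U" and f: "holo_fun A U f"
  shows "openin X {p \<in> U. f p \<noteq> 0}"
proof (subst openin_subopen, intro ballI)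
  fix p assume p: "p \<in> {p \<in> U. f p \<noteq> 0}"
  then obtain c where c: "c \<in> A" "p \<in> cdom c"
    using chart_at openin_subset[OF U] by blast
  let ?S = "coord c ` (cdom c \<inter> U)"
  let ?T = "?S \<inter> (f \<circ> chart_inv c) -` (- {0})"
  have "open ?S" by (rule open_coord_image[OF c(1) U])
  moreover have "continuous_on ?S (f \<circ> chart_inv c)"
    using f c(1) holo_on_imp_continuous_on unfolding holo_fun_def by blast
  ultimately have "open ?T" using continuous_open_preimage by blast
  then have "openin X {q \<in> cdom c. coord c q \<in> ?T}" by (rule openin_coord_preimage[OF c(1)])
  moreover have "p \<in> {q \<in> cdom c. coord c q \<in> ?T}"
    using p c chart_inv_coord[OF c(1)] by auto
  moreover have "{q \<in> cdom c. coord c q \<in> ?T} \<subseteq> {p \<in> U. f p \<noteq> 0}"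
    using chart_inv_coord[OF c(1)] inj_on_coord[OF c(1)] by (auto simp: inj_on_def)
  ultimately show "\<exists>T. openin X T \<and> p \<in> T \<and> T \<subseteq> {p \<in> U. f p \<noteq> 0}" by blast
qed

text \<open>If \<open>u\<close> and \<open>v\<close> differed at \<open>p\<close>, they would differ
  on a nonempty open set, and there \<open>f\<close> would have to vanish, which a local equation
  cannot. The conclusion also holds at zeros of \<open>f\<close>.\<close>

lemma local_equation_cancel:
  assumes f: "local_equation X A U f" and W: "openin X W" "W \<subseteq> U"
    and "holo_fun A W u" "holo_fun A W v" and eq: "\<And>p. p \<in> W \<Longrightarrow> u p * f p = v p * f p"
    and p: "p \<in> W"
  shows "u p = v p"
proof (rule ccontr)
  assume ne: "u p \<noteq> v p"
  let ?Z = "{p \<in> W. u p - v p \<noteq> 0}"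
  have "openin X ?Z" by (intro openin_nonzero W holo_fun_diff assms)
  moreover have "?Z \<noteq> {}" using ne p by auto
  moreover have "?Z \<subseteq> U" using W(2) by blast
  ultimately obtain q where "q \<in> ?Z" "f q \<noteq> 0"
    using f unfolding local_equation_def by blast
  then show False using eq[of q] by auto
qed

text \<open>Stated for a family with one function per chart whose vanishing at a point is
  independent of the chart, so that it applies to sections of line bundles and not only to global
  functions.\<close>

lemma identity_theorem:
  assumes conn: "connected_space X"
    and g: "\<And>c. c \<in> A \<Longrightarrow> holo_fun A (cdom c) (g c)"
    and compat: "\<And>c d q. c \<in> A \<Longrightarrow> d \<in> A \<Longrightarrow> q \<in> cdom c \<Longrightarrow> q \<in> cdom d \<Longrightarrow> g c q = 0 \<Longrightarrow> g d q = 0"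
    and nz: "c0 \<in> A" "p0 \<in> cdom c0" "g c0 p0 \<noteq> 0"
    and W: "openin X W" "W \<noteq> {}" and c: "c \<in> A" "W \<subseteq> cdom c"
  shows "\<exists>p\<in>W. g c p \<noteq> 0"
proof (rule ccontr)
  assume "\<not> ?thesis"
  then have W0: "\<forall>p\<in>W. g c p = 0" by blast
  \<comment> \<open>\<open>Z\<close> below is the interior of the common zero set; it is shown to be
    clopen.\<close>
  define null where "null = (\<lambda>W. \<forall>c\<in>A. \<forall>q\<in>W \<inter> cdom c. g c q = 0)"
  define Z where "Z = \<Union> {W. openin X W \<and> null W}"
  have opZ: "openin X Z" unfolding Z_def by (rule openin_Union) blast
  have "W \<subseteq> Z"
    using W W0 c compat unfolding Z_def null_def by blast
  \<comment> \<open>A coordinate ball around \<open>p\<close> that meets \<open>Z\<close> contains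
    an open piece of zeros; balls are convex, so the function vanishes on the whole ball and
    \<open>p\<close> would lie in \<open>Z\<close>.\<close>
  have "openin X (topspace X - Z)"
  proof (subst openin_subopen, intro ballI)
    fix p assume p: "p \<in> topspace X - Z"
    then obtain d where d: "d \<in> A" "p \<in> cdom d" using chart_at by blast
    have "open (coord d ` cdom d)" using chart[OF d(1)] unfolding is_chart_def by blast
    then obtain e where e: "e > 0" "ball (coord d p) e \<subseteq> coord d ` cdom d"
      using d(2) openE by blast
    let ?B = "ball (coord d p) e"
    let ?V = "{q \<in> cdom d. coord d q \<in> ?B}"
    have V: "openin X ?V" by (rule openin_coord_preimage[OF d(1) open_ball])
    have "q \<notin> Z" if q: "q \<in> ?V" for q
    proof
      assume "q \<in> Z"
      then obtain W' where W': "openin X W'" "null W'" "q \<in> W'" unfolding Z_def by blast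
      let ?U = "?B \<inter> coord d ` (cdom d \<inter> W')"
      have "(g d \<circ> chart_inv d) z = 0" if "z \<in> ?B" for z
      proof (rule holo_on_zero_propagates[of ?B _ ?U])
        show "holo_on ?B (g d \<circ> chart_inv d)"
          using g[OF d(1)] d(1) e(2) holo_on_subset unfolding holo_fun_def by (metis Int_absorb)
        show "open ?U" using open_coord_image[OF d(1) W'(1)] by blast
        show "?U \<noteq> {}" using q W'(3) by blast
        show "(g d \<circ> chart_inv d) z = 0" if "z \<in> ?U" for z
          using that W'(2) d(1) chart_inv_coord[OF d(1)] unfolding null_def by auto
      qed (use that in auto)
      then have "\<forall>q\<in>?V. g d q = 0" using chart_inv_coord[OF d(1)] by force
      then have "null ?V" using compat d(1) unfolding null_def by blast
      moreover have "p \<in> ?V" using d(2) e(1) by simp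
      ultimately have "p \<in> Z" using V unfolding Z_def by blast
      then show False using p by blast
    qed
    then show "\<exists>T. openin X T \<and> p \<in> T \<and> T \<subseteq> topspace X - Z"
      using V d(2) e(1) openin_subset[OF V] by (intro exI[of _ ?V]) auto
  qed
  then have "closedin X Z" using opZ openin_subset unfolding closedin_def by blast
  then have "Z = {} \<or> Z = topspace X" using conn opZ connected_space_clopen_in by blast
  moreover have "Z \<noteq> {}" using \<open>W \<subseteq> Z\<close> W(2) by blast
  moreover have "p0 \<notin> Z" using nz unfolding Z_def null_def by blast
  moreover have "p0 \<in> topspace X" using nz openin_subset[OF openin_cdom] by blast
  ultimately show False by blast
qed

section \<open>The Jacobian cocycle of the anticanonical bundle\<close>

lemma holo_cocycle:
  assumes c: "c \<in> A" and d: "d \<in> A"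
  shows "holo_fun A (cdom c \<inter> cdom d) (\<lambda>p. det (matrix (transition_deriv c d p)))"
proof (rule holo_fun_chartI[OF c])
  let ?S = "coord c ` (cdom c \<inter> cdom d)"
  have op: "openin X (cdom c \<inter> cdom d)" using openin_cdom c d by (simp add: openin_Int)
  show "openin X (cdom c \<inter> cdom d)" by (rule op)
  have opS: "open ?S" by (rule open_coord_image[OF c openin_cdom[OF d]])
  have "holo_on ?S (\<lambda>z. det (matrix (frechet_derivative (transition c d) (at z))))"
  proof (rule holo_on_det)
    fix k l
    have "holo_on ?S (\<lambda>z. transition c d z $ k)"
      using holo_transition[OF c d] unfolding holo_vec_on_def by blast
    then have "holo_on ?S (\<lambda>z. frechet_derivative (\<lambda>z. transition c d z $ k) (at z) (axis l 1))"
      by (rule holo_on_frechet_derivative[OF opS])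
    then show "holo_on ?S (\<lambda>z. matrix (frechet_derivative (transition c d) (at z)) $ k $ l)"
      by (rule holo_on_cong[OF _ opS])
         (simp add: matrix_def frechet_derivative_vec(2)[OF holo_transition[OF c d]])
  qed
  then show "holo_on ?S ((\<lambda>p. det (matrix (transition_deriv c d p))) \<circ> chart_inv c)"
    by (rule holo_on_cong[OF _ opS]) (auto simp: transition_deriv_def chart_inv_coord[OF c])
qed auto

text \<open>The two transition maps are inverse to each other near the point, so by the chain rule
  their Jacobian matrices are inverse too.\<close>

lemma cocycle_nonzero:
  assumes c: "c \<in> A" "p \<in> cdom c" and d: "d \<in> A" "p \<in> cdom d"
  shows "det (matrix (transition_deriv c d p)) \<noteq> 0"
proof -
  let ?S = "coord c ` (cdom c \<inter> cdom d)"
  have z: "coord c p \<in> ?S" using c d by blast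
  have opS: "open ?S" by (rule open_coord_image[OF c(1) openin_cdom[OF d(1)]])
  have "(transition c d has_derivative transition_deriv c d p) (at (coord c p))"
    unfolding transition_deriv_def
    by (rule frechet_derivative_vec(1)[OF holo_transition[OF c(1) d(1)] z])
  moreover have "(transition d c has_derivative transition_deriv d c p) (at (transition c d (coord c p)))"
    unfolding transition_deriv_def transition_coord[OF c]
    by (rule frechet_derivative_vec(1)[OF holo_transition[OF d(1) c(1)]]) (use c d in blast)
  ultimately have "(transition d c \<circ> transition c d has_derivative transition_deriv d c p \<circ> transition_deriv c d p) (at (coord c p))"
    by (rule diff_chain_at)
  then have "((\<lambda>z. z) has_derivative transition_deriv d c p \<circ> transition_deriv c d p) (at (coord c p))"
    by (rule has_derivative_transform_within_open[OF _ opS z])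
       (auto simp: transition_coord[OF c(1)] transition_coord[OF d(1)])
  then have "transition_deriv d c p \<circ> transition_deriv c d p = (\<lambda>v. v)"
    using has_derivative_unique has_derivative_ident by blast
  then have "transition_deriv d c p (transition_deriv c d p v) = v" for v
    by (metis o_apply)
  then have "matrix (transition_deriv d c p) ** matrix (transition_deriv c d p) = mat 1"
    unfolding matrix_eq matrix_vector_mul_assoc[symmetric]
    using transition_deriv_linear(3)[OF c(1) d(1) c(2) d(2)] transition_deriv_linear(3)[OF d(1) c(1) d(2) c(2)]
    by simp
  then have "det (matrix (transition_deriv d c p)) * det (matrix (transition_deriv c d p)) = 1"
    by (metis det_I det_mul)
  then show ?thesis by auto
qed

lemma holo_unit_cocycle:
  "c \<in> A \<Longrightarrow> d \<in> A \<Longrightarrow> holo_unit A (cdom c \<inter> cdom d) (\<lambda>p. det (matrix (transition_deriv c d p)))"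
  unfolding holo_unit_def using holo_cocycle cocycle_nonzero by blast

end

text \<open>Generation at the general point enters as a single point with nonzero wedge product;
  connectedness spreads this to every nonempty open set.\<close>

locale holomorphic_frame = complex_atlas X A
  for X :: "'a topology" and A :: "('a, complex^'n) chart set" +
  fixes s :: "'n \<Rightarrow> ('a, 'n) vfield"
  assumes fields: "\<And>i. holomorphic_vector_field A (s i)"
    and connected: "connected_space X"
    and generic: "\<exists>c\<in>A. \<exists>p\<in>cdom c. wedge s c p \<noteq> 0"
begin

lemma holo_field: "c \<in> A \<Longrightarrow> holo_fun A (cdom c) (\<lambda>p. s i c p $ k)"
  using fields unfolding holomorphic_vector_field_def by blast

lemma field_transition:
  "c \<in> A \<Longrightarrow> d \<in> A \<Longrightarrow> p \<in> cdom c \<Longrightarrow> p \<in> cdom d \<Longrightarrow> s i d p = transition_deriv c d p (s i c p)"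
  using fields unfolding holomorphic_vector_field_def by blast

lemma holo_wedge: "c \<in> A \<Longrightarrow> holo_fun A (cdom c) (wedge s c)"
  unfolding wedge_def[abs_def] by (rule holo_fun_det) (simp add: frame_matrix_def holo_field)

text \<open>The fields are rows of the frame matrix, so the Jacobian matrix acts from the right by
  its transpose, which has the same determinant.\<close>

lemma wedge_transition:
  assumes "c \<in> A" "d \<in> A" "p \<in> cdom c" "p \<in> cdom d"
  shows "wedge s d p = det (matrix (transition_deriv c d p)) * wedge s c p"
proof -
  let ?T = "matrix (transition_deriv c d p)"
  have "s i d p = ?T *v s i c p" for i
    using transition_deriv_linear(3)[OF assms] field_transition[OF assms] by simp
  then have "frame_matrix s d p = frame_matrix s c p ** transpose ?T"
    by (simp add: vec_eq_iff frame_matrix_def matrix_vector_mult_def matrix_matrix_mult_def transpose_def mult.commute)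
  then show ?thesis by (simp add: wedge_def det_mul det_transpose)
qed

lemma wedge_zero_transition:
  "c \<in> A \<Longrightarrow> d \<in> A \<Longrightarrow> p \<in> cdom c \<Longrightarrow> p \<in> cdom d \<Longrightarrow> wedge s c p = 0 \<Longrightarrow> wedge s d p = 0"
  by (simp only: wedge_transition[of c d p] mult_zero_right)

text \<open>The transformation law makes vanishing independent of the chart, so
  \<open>identity_theorem\<close> excludes open sets of zeros.\<close>

lemma local_equation_wedge:
  assumes c: "c \<in> A" shows "local_equation X A (cdom c) (wedge s c)"
proof -
  obtain c0 p0 where nz: "c0 \<in> A" "p0 \<in> cdom c0" "wedge s c0 p0 \<noteq> 0" using generic by blast
  have "\<exists>p\<in>W. wedge s c p \<noteq> 0" if "openin X W" "W \<subseteq> cdom c" "W \<noteq> {}" for W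
    using identity_theorem[OF connected holo_wedge wedge_zero_transition nz that(1,3) c that(2)] .
  then show ?thesis unfolding local_equation_def using openin_cdom[OF c] holo_wedge[OF c] by blast
qed

lemma holo_section_wedge: "holo_section A (anticanonical_bundle A) (wedge s)"
  unfolding holo_section_def anticanonical_bundle_def line_bundle.simps
  by (intro conjI ballI holo_wedge wedge_transition) auto

subsection \<open>The divisor\<close>

abbreviation "D \<equiv> frame_divisor X A s"

lemma mem_divisor:
  "(U, f) \<in> D \<longleftrightarrow> local_equation X A U f \<and> (\<forall>c\<in>A. associated A (U \<inter> cdom c) f (wedge s c))"
  unfolding frame_divisor_def divisor_of_zeros_def anticanonical_bundle_def by simp

lemma chart_mem_divisor:
  assumes c: "c \<in> A" shows "(cdom c, wedge s c) \<in> D"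
  unfolding mem_divisor
proof (intro conjI ballI local_equation_wedge c)
  fix d assume d: "d \<in> A"
  show "associated A (cdom c \<inter> cdom d) (wedge s c) (wedge s d)"
    unfolding associated_def using holo_unit_cocycle[OF c d] wedge_transition[OF c d] by blast
qed

lemma divisor_open: "(U, f) \<in> D \<Longrightarrow> openin X U"
  unfolding mem_divisor local_equation_def by blast

text \<open>These units are the local expressions of the isomorphism from \<open>O(D)\<close> to the
  anticanonical bundle that sends \<open>m\<close> to \<open>m\<close> times the wedge section: the
  coordinate \<open>m * f\<close> becomes \<open>m * wedge s c\<close>, which is the unit times
  \<open>m * f\<close>. By cancellation the choice is unique on
  \<open>fst x \<inter> cdom c\<close>.\<close>

definition trivialization :: "'a set \<times> ('a \<Rightarrow> complex) \<Rightarrow> ('a, complex^'n) chart \<Rightarrow> 'a \<Rightarrow> complex" where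
  "trivialization x c = (SOME u. holo_unit A (fst x \<inter> cdom c) u \<and> (\<forall>p\<in>fst x \<inter> cdom c. wedge s c p = u p * snd x p))"

lemma trivialization:
  assumes x: "(U, f) \<in> D" and c: "c \<in> A"
  shows "holo_unit A (U \<inter> cdom c) (trivialization (U, f) c)"
    and "\<And>p. p \<in> U \<Longrightarrow> p \<in> cdom c \<Longrightarrow> wedge s c p = trivialization (U, f) c p * f p"
proof -
  have "\<exists>u. holo_unit A (U \<inter> cdom c) u \<and> (\<forall>p\<in>U \<inter> cdom c. wedge s c p = u p * f p)"
    using x c unfolding mem_divisor associated_def by blast
  then have *: "holo_unit A (U \<inter> cdom c) (trivialization (U, f) c) \<and>
      (\<forall>p\<in>U \<inter> cdom c. wedge s c p = trivialization (U, f) c p * f p)"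
    unfolding trivialization_def fst_conv snd_conv by (rule someI_ex)
  then show "holo_unit A (U \<inter> cdom c) (trivialization (U, f) c)" by blast
  show "wedge s c p = trivialization (U, f) c p * f p" if "p \<in> U" "p \<in> cdom c" for p
    using * that by blast
qed

lemma support_wedge:
  assumes "(U, f) \<in> D" "c \<in> A" "p \<in> U" "p \<in> cdom c"
  shows "f p = 0 \<longleftrightarrow> wedge s c p = 0"
  using trivialization[OF assms(1,2)] assms(3,4) unfolding holo_unit_def by simp

lemma section_zeros_eq_support: "section_zeros (anticanonical_bundle A) (wedge s) = divisor_support D"
proof -
  have "section_zeros (anticanonical_bundle A) (wedge s) = {p. \<exists>c\<in>A. p \<in> cdom c \<and> wedge s c p = 0}"
    unfolding section_zeros_def anticanonical_bundle_def by simp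
  also have "\<dots> = divisor_support D"
  proof (intro equalityI subsetI)
    fix p assume "p \<in> {p. \<exists>c\<in>A. p \<in> cdom c \<and> wedge s c p = 0}"
    then obtain c where "c \<in> A" "p \<in> cdom c" "wedge s c p = 0" by blast
    then show "p \<in> divisor_support D"
      using chart_mem_divisor[of c] unfolding divisor_support_def by blast
  next
    fix p assume "p \<in> divisor_support D"
    then obtain U f where x: "(U, f) \<in> D" "p \<in> U" "f p = 0"
      unfolding divisor_support_def by blast
    obtain c where c: "c \<in> A" "p \<in> cdom c"
      using chart_at x(2) openin_subset[OF divisor_open[OF x(1)]] by blast
    have "wedge s c p = 0" using support_wedge[OF x(1) c(1) x(2) c(2)] x(3) by simp
    then show "p \<in> {p. \<exists>c\<in>A. p \<in> cdom c \<and> wedge s c p = 0}" using c by blast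
  qed
  finally show ?thesis .
qed

text \<open>In each chart both \<open>f\<close> and \<open>h\<close> are unit multiples of the wedge
  product, so \<open>h\<close> is \<open>f\<close> times a quotient of units. Cancelling
  \<open>f\<close> shows that the quotients from different charts agree on overlaps, hence they
  glue.\<close>

lemma divisor_associated:
  assumes x: "(U, f) \<in> D" and y: "(V, h) \<in> D"
  shows "associated A (U \<inter> V) f h"
proof -
  define q where "q = (\<lambda>c p. trivialization (U, f) c p * inverse (trivialization (V, h) c p))"
  \<comment> \<open>An arbitrary chart at each point: once \<open>q\<close> is independent of the
    chart, \<open>q (ch p) p\<close> coincides near each point with \<open>q c\<close> for one fixed
    \<open>c\<close>, and so is holomorphic.\<close>
  define ch where "ch = (\<lambda>p. SOME c. c \<in> A \<and> p \<in> cdom c)"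
  have ch: "ch p \<in> A" "p \<in> cdom (ch p)" if "p \<in> U" for p
  proof -
    have "\<exists>c. c \<in> A \<and> p \<in> cdom c"
      using chart_at that openin_subset[OF divisor_open[OF x]] by blast
    then have "ch p \<in> A \<and> p \<in> cdom (ch p)" unfolding ch_def by (rule someI_ex)
    then show "ch p \<in> A" "p \<in> cdom (ch p)" by auto
  qed
  have op: "openin X (U \<inter> V)" using divisor_open[OF x] divisor_open[OF y] by (rule openin_Int)
  have holo: "holo_fun A (U \<inter> V \<inter> cdom c) (q c)" if c: "c \<in> A" for c
    unfolding q_def
  proof (intro holo_fun_mult holo_fun_inverse)
    show "holo_fun A (U \<inter> V \<inter> cdom c) (trivialization (U, f) c)"
      using trivialization(1)[OF x c] unfolding holo_unit_def by (auto intro: holo_fun_subset)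
    show "holo_fun A (U \<inter> V \<inter> cdom c) (trivialization (V, h) c)"
      using trivialization(1)[OF y c] unfolding holo_unit_def by (auto intro: holo_fun_subset)
    show "trivialization (V, h) c p \<noteq> 0" if "p \<in> U \<inter> V \<inter> cdom c" for p
      using trivialization(1)[OF y c] that unfolding holo_unit_def by blast
  qed
  have qf: "h p = q c p * f p" if "c \<in> A" "p \<in> U \<inter> V \<inter> cdom c" for c p
  proof -
    have "trivialization (V, h) c p \<noteq> 0"
      using trivialization(1)[OF y that(1)] that(2) unfolding holo_unit_def by blast
    moreover have "trivialization (V, h) c p * h p = trivialization (U, f) c p * f p"
      using trivialization(2)[OF x that(1), of p, symmetric] trivialization(2)[OF y that(1), of p, symmetric] that(2)
      by simp
    ultimately show ?thesis unfolding q_def by (simp add: field_simps)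
  qed
  have agree: "q c p = q d p" if c: "c \<in> A" "p \<in> cdom c" and d: "d \<in> A" "p \<in> cdom d" and p: "p \<in> U" "p \<in> V" for c d p
  proof (rule local_equation_cancel[where W="U \<inter> V \<inter> (cdom c \<inter> cdom d)"])
    show "local_equation X A U f" using x unfolding mem_divisor by blast
    show "openin X (U \<inter> V \<inter> (cdom c \<inter> cdom d))"
      by (intro openin_Int op openin_cdom c d divisor_open[OF x] divisor_open[OF y])
    show "holo_fun A (U \<inter> V \<inter> (cdom c \<inter> cdom d)) (q c)" by (rule holo_fun_subset[OF holo[OF c(1)]]) blast
    show "holo_fun A (U \<inter> V \<inter> (cdom c \<inter> cdom d)) (q d)" by (rule holo_fun_subset[OF holo[OF d(1)]]) blast
    show "q c r * f r = q d r * f r" if "r \<in> U \<inter> V \<inter> (cdom c \<inter> cdom d)" for r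
      using qf[OF c(1), of r, symmetric] qf[OF d(1), of r, symmetric] that by simp
  qed (use c d p in auto)
  have eq: "q (ch r) r = q c r" if "c \<in> A" "r \<in> U \<inter> V \<inter> cdom c" for c r
    using agree[OF ch that(1)] that(2) by blast
  have "holo_unit A (U \<inter> V) (\<lambda>p. q (ch p) p)"
    unfolding holo_unit_def
  proof (intro conjI ballI)
    show "holo_fun A (U \<inter> V) (\<lambda>p. q (ch p) p)"
    proof (rule holo_fun_localI)
      fix p assume p: "p \<in> U \<inter> V"
      let ?c = "ch p"
      have c: "?c \<in> A" "p \<in> cdom ?c" using ch p by blast+
      have "holo_fun A (U \<inter> V \<inter> cdom ?c) (\<lambda>r. q (ch r) r)"
        by (rule holo_fun_cong[OF holo[OF c(1)] openin_Int[OF op openin_cdom[OF c(1)]]])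
           (rule eq[OF c(1), symmetric])
      moreover have "p \<in> U \<inter> V \<inter> cdom ?c" using p c(2) by blast
      ultimately show "\<exists>W. p \<in> W \<and> holo_fun A W (\<lambda>r. q (ch r) r)" by (intro exI conjI)
    qed
    fix p assume p: "p \<in> U \<inter> V"
    have c: "ch p \<in> A" "p \<in> cdom (ch p)" using ch p by blast+
    show "q (ch p) p \<noteq> 0"
      using trivialization(1)[OF x c(1)] trivialization(1)[OF y c(1)] p c(2) unfolding holo_unit_def q_def by simp
  qed
  moreover have "h p = q (ch p) p * f p" if "p \<in> U \<inter> V" for p
    using qf[OF ch(1)] ch(2) that by blast
  ultimately show ?thesis unfolding associated_def by blast
qed

text \<open>The set of equations is maximal because the chart equations \<open>wedge s c\<close>
  belong to it: whatever is associated with all members is associated with these, which is the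
  membership condition.\<close>

lemma effective_divisor_D: "effective_divisor X A D"
  unfolding effective_divisor_def
proof (intro conjI equalityI subsetI)
  fix p assume "p \<in> (\<Union>(U, f)\<in>D. U)"
  then show "p \<in> topspace X" using divisor_open openin_subset by blast
next
  fix p assume "p \<in> topspace X"
  then obtain c where "c \<in> A" "p \<in> cdom c" using chart_at by blast
  then show "p \<in> (\<Union>(U, f)\<in>D. U)" using chart_mem_divisor[of c] by blast
next
  fix x assume "x \<in> D"
  moreover obtain U f where "x = (U, f)" by (cases x)
  ultimately show "x \<in> {(U, f). local_equation X A U f \<and> (\<forall>(V, h)\<in>D. associated A (U \<inter> V) f h)}"
    using divisor_associated mem_divisor by blast
next
  fix x assume *: "x \<in> {(U, f). local_equation X A U f \<and> (\<forall>(V, h)\<in>D. associated A (U \<inter> V) f h)}"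
  obtain U f where x: "x = (U, f)" by (cases x)
  have "associated A (U \<inter> cdom c) f (wedge s c)" if "c \<in> A" for c
    using * chart_mem_divisor[OF that] unfolding x by blast
  then show "x \<in> D" using * unfolding x mem_divisor by blast
qed

text \<open>The definite description denotes: a unit exists by \<open>divisor_associated\<close>,
  and its values, even over zeros of \<open>f\<close>, are unique by cancellation.\<close>

lemma unit_quotient:
  assumes x: "(U, f) \<in> D" and y: "(V, h) \<in> D"
  shows "holo_fun A (U \<inter> V) (unit_quotient A (U \<inter> V) h f)"
    and "\<And>p. p \<in> U \<inter> V \<Longrightarrow> h p = unit_quotient A (U \<inter> V) h f p * f p"
proof -
  have op: "openin X (U \<inter> V)" using divisor_open[OF x] divisor_open[OF y] by (rule openin_Int)
  obtain u where u: "holo_unit A (U \<inter> V) u" "\<forall>p\<in>U \<inter> V. h p = u p * f p"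
    using divisor_associated[OF x y] unfolding associated_def by blast
  have eq: "unit_quotient A (U \<inter> V) h f p = u p" if p: "p \<in> U \<inter> V" for p
    unfolding unit_quotient_def
  proof (rule the_equality)
    show "\<exists>w. holo_unit A (U \<inter> V) w \<and> (\<forall>q\<in>U \<inter> V. h q = w q * f q) \<and> w p = u p" using u by blast
    fix y assume "\<exists>w. holo_unit A (U \<inter> V) w \<and> (\<forall>q\<in>U \<inter> V. h q = w q * f q) \<and> w p = y"
    then obtain w where w: "holo_unit A (U \<inter> V) w" "\<forall>q\<in>U \<inter> V. h q = w q * f q" "w p = y" by blast
    have "w p = u p"
    proof (rule local_equation_cancel[OF _ op _ _ _ _ p])
      show "local_equation X A U f" using x unfolding mem_divisor by blast
      show "w q * f q = u q * f q" if "q \<in> U \<inter> V" for q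
        using w(2) u(2) that by metis
    qed (use w(1) u(1) in \<open>simp_all add: holo_unit_def\<close>)
    then show "y = u p" using w(3) by simp
  qed
  show "holo_fun A (U \<inter> V) (unit_quotient A (U \<inter> V) h f)"
    by (rule holo_fun_cong[OF _ op]) (use u(1) eq in \<open>auto simp: holo_unit_def\<close>)
  show "h p = unit_quotient A (U \<inter> V) h f p * f p" if "p \<in> U \<inter> V" for p
    using u(2) eq[OF that] that by simp
qed

text \<open>After multiplication by \<open>f\<close> both sides equal \<open>wedge s d\<close>;
  cancelling \<open>f\<close> gives the identity on the support as well.\<close>

lemma trivialization_cocycle:
  assumes x: "(U, f) \<in> D" and y: "(V, h) \<in> D" and c: "c \<in> A" and d: "d \<in> A"
    and p: "p \<in> U \<inter> V \<inter> cdom c \<inter> cdom d"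
  shows "trivialization (V, h) d p * unit_quotient A (U \<inter> V) h f p
     = det (matrix (transition_deriv c d p)) * trivialization (U, f) c p"
proof -
  let ?W = "U \<inter> V \<inter> cdom c \<inter> cdom d"
  show ?thesis
  proof (rule local_equation_cancel[where W="?W" and f=f and U=U and p=p
      and u="\<lambda>p. trivialization (V, h) d p * unit_quotient A (U \<inter> V) h f p"
      and v="\<lambda>p. det (matrix (transition_deriv c d p)) * trivialization (U, f) c p"])
    show "local_equation X A U f" using x unfolding mem_divisor by blast
    show "openin X ?W"
      by (intro openin_Int openin_cdom c d divisor_open[OF x] divisor_open[OF y])
    show "holo_fun A ?W (\<lambda>p. trivialization (V, h) d p * unit_quotient A (U \<inter> V) h f p)"
    proof (rule holo_fun_mult)
      show "holo_fun A ?W (trivialization (V, h) d)"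
        using trivialization(1)[OF y d] unfolding holo_unit_def by (auto intro: holo_fun_subset)
      show "holo_fun A ?W (unit_quotient A (U \<inter> V) h f)"
        by (rule holo_fun_subset[OF unit_quotient(1)[OF x y]]) blast
    qed
    show "holo_fun A ?W (\<lambda>p. det (matrix (transition_deriv c d p)) * trivialization (U, f) c p)"
    proof (rule holo_fun_mult)
      show "holo_fun A ?W (\<lambda>p. det (matrix (transition_deriv c d p)))"
        by (rule holo_fun_subset[OF holo_cocycle[OF c d]]) blast
      show "holo_fun A ?W (trivialization (U, f) c)"
        using trivialization(1)[OF x c] unfolding holo_unit_def by (auto intro: holo_fun_subset)
    qed
    fix q assume q: "q \<in> ?W"
    have "trivialization (V, h) d q * unit_quotient A (U \<inter> V) h f q * f q = trivialization (V, h) d q * h q"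
      using unit_quotient(2)[OF x y, of q] q by simp
    also have "\<dots> = wedge s d q" using trivialization(2)[OF y d, of q] q by simp
    also have "\<dots> = det (matrix (transition_deriv c d q)) * (trivialization (U, f) c q * f q)"
      using wedge_transition[OF c d, of q] trivialization(2)[OF x c, of q] q by simp
    finally show "trivialization (V, h) d q * unit_quotient A (U \<inter> V) h f q * f q
        = det (matrix (transition_deriv c d q)) * trivialization (U, f) c q * f q" by simp
  qed (use p in auto)
qed

lemma divisor_in_anticanonical_system:
  "D \<in> complete_linear_system X A (anticanonical_bundle A)"
proof -
  have "line_bundle_iso A (divisor_line_bundle A D) (anticanonical_bundle A)"
    unfolding line_bundle_iso_def divisor_line_bundle_def anticanonical_bundle_def line_bundle.simps
  proof (intro exI[of _ trivialization] conjI ballI)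
    fix x c assume x: "x \<in> D" and c: "c \<in> A"
    show "holo_unit A (fst x \<inter> cdom c) (trivialization x c)"
      using trivialization(1)[of "fst x" "snd x"] x c by simp
    fix y d p assume y: "y \<in> D" and d: "d \<in> A" and p: "p \<in> fst x \<inter> fst y \<inter> cdom c \<inter> cdom d"
    show "trivialization y d p * (case x of (U, f) \<Rightarrow> \<lambda>(V, h). unit_quotient A (U \<inter> V) h f) y p
        = det (matrix (transition_deriv c d p)) * trivialization x c p"
      using trivialization_cocycle[of "fst x" "snd x" "fst y" "snd y", OF _ _ c d p] x y
      by (simp add: case_prod_unfold)
  qed
  then show ?thesis unfolding complete_linear_system_def using effective_divisor_D by blast
qed

end

subsection \<open>The logarithm of the squared norm of a holomorphic function\<close>

text \<open>No branch of the logarithm of \<open>h\<close> is chosen. The first derivative is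
  computed directly: it is the conjugate of the logarithmic derivative \<open>m\<close>, thus
  antiholomorphic, and the second derivative kills it.\<close>

lemma wirtinger_wirtinger_bar_ln:
  fixes h :: "complex^'n \<Rightarrow> complex"
  assumes S: "open S" and h: "holo_on S h" and nz: "\<And>z. z \<in> S \<Longrightarrow> h z \<noteq> 0"
    and F: "\<And>z. z \<in> S \<Longrightarrow> F z = ln (h z * cnj (h z))" and z: "z \<in> S"
  shows "wirtinger j (wirtinger_bar k F) z = 0"
proof -
  have axis_i: "axis l \<i> = \<i> *s (axis l 1 :: complex^'n)" for l
    by (simp add: vec_eq_iff axis_def)
  define m where "m = (\<lambda>z. frechet_derivative h (at z) (axis k 1) / h z)"
  have m: "holo_on S m"
    unfolding m_def by (intro holo_on_divide holo_on_frechet_derivative S h nz)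
  have bar: "wirtinger_bar k F z = cnj (m z)" if z: "z \<in> S" for z
  proof -
    let ?D = "frechet_derivative h (at z)"
    let ?N = "\<lambda>z. h z * cnj (h z)"
    have hD: "(h has_derivative ?D) (at z)" by (rule holo_onD(1)[OF h z])
    have N: "(?N has_derivative (\<lambda>v. h z * cnj (?D v) + ?D v * cnj (h z))) (at z)"
      by (intro has_derivative_mult hD bounded_linear.has_derivative[OF bounded_linear_cnj])
    \<comment> \<open>The argument of \<open>ln\<close> is a positive real number, hence off the
      branch cut.\<close>
    have "complex_of_real r \<notin> \<real>\<^sub>\<le>\<^sub>0" if "r > 0" for r
      using that by (simp add: complex_nonpos_Reals_iff)
    then have "complex_of_real ((cmod (h z))\<^sup>2) \<notin> \<real>\<^sub>\<le>\<^sub>0"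
      using nz[OF z] by (metis zero_less_norm_iff zero_less_power)
    then have "?N z \<notin> \<real>\<^sub>\<le>\<^sub>0" unfolding complex_norm_square .
    then have "(ln has_derivative (\<lambda>w. inverse (?N z) * w)) (at (?N z))"
      using has_field_derivative_Ln unfolding has_field_derivative_def by blast
    from diff_chain_at[OF N this]
    have "((\<lambda>z. ln (?N z)) has_derivative (\<lambda>v. inverse (?N z) * (h z * cnj (?D v) + ?D v * cnj (h z)))) (at z)"
      by (simp add: o_def)
    then have "(F has_derivative (\<lambda>v. inverse (?N z) * (h z * cnj (?D v) + ?D v * cnj (h z)))) (at z)"
      by (rule has_derivative_transform_within_open[OF _ S z]) (rule F[symmetric])
    then have FD: "frechet_derivative F (at z) = (\<lambda>v. inverse (?N z) * (h z * cnj (?D v) + ?D v * cnj (h z)))"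
      by (rule frechet_derivative_at[symmetric])
    \<comment> \<open>By complex linearity the values at \<open>axis k \<i>\<close> are
      \<open>\<i>\<close> times those at \<open>axis k 1\<close>, so the terms with unconjugated
      \<open>?D\<close> cancel and the conjugated ones double.\<close>
    have "wirtinger_bar k F z = inverse (?N z) * (h z * cnj (?D (axis k 1)))"
      unfolding wirtinger_bar_def axis_i FD holo_onD(2)[OF h z] by (simp add: algebra_simps)
    also have "\<dots> = cnj (m z)"
      using nz[OF z] by (simp add: m_def field_simps)
    finally show ?thesis .
  qed
  have "frechet_derivative (wirtinger_bar k F) (at z) = frechet_derivative (\<lambda>z. cnj (m z)) (at z)"
    by (rule frechet_derivative_cong[OF S z bar])
  also have "\<dots> = (\<lambda>v. cnj (frechet_derivative m (at z) v))"
    by (rule frechet_derivative_at[symmetric])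
       (rule bounded_linear.has_derivative[OF bounded_linear_cnj holo_onD(1)[OF m z]])
  finally show ?thesis
    unfolding wirtinger_def axis_i by (simp add: holo_onD(2)[OF m z])
qed

subsection \<open>The exterior derivative of the fundamental form in coordinates\<close>

locale local_frame =
  fixes S :: "(complex^'n) set" and M :: "complex^'n \<Rightarrow> complex^'n^'n"
  assumes open_S: "open S"
    and holo_M: "\<And>i j. holo_on S (\<lambda>z. M z $ i $ j)"
    and det_M: "\<And>z. z \<in> S \<Longrightarrow> det (M z) \<noteq> 0"
begin

lemma holo_inv: "holo_on S (\<lambda>z. matrix_inv (M z) $ i $ j)"
  by (rule holo_on_matrix_inv[OF open_S holo_M det_M])

text \<open>The coefficients of the coframe are differentiated along \<open>u\<close> while
  \<open>v\<close> stays constant; antisymmetrising in \<open>u\<close> and \<open>v\<close> gives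
  the exterior derivatives of the dual forms.\<close>

definition dcoframe :: "complex^'n \<Rightarrow> complex^'n \<Rightarrow> complex^'n \<Rightarrow> complex^'n" where
  "dcoframe z u v = (\<chi> k. \<Sum>i\<in>UNIV. v $ i * frechet_derivative (\<lambda>z. matrix_inv (M z) $ i $ k) (at z) u)"

lemma has_derivative_coframe:
  assumes z: "z \<in> S"
  shows "((\<lambda>x. coframe (M x) v $ k) has_derivative (\<lambda>u. dcoframe z u v $ k)) (at z)"
  unfolding coframe_nth dcoframe_def vec_lambda_beta
  by (intro has_derivative_sum has_derivative_mult_right holo_onD(1)[OF holo_inv z])

lemma dcoframe_linear:
  assumes z: "z \<in> S"
  shows "dcoframe z (u + u') v = dcoframe z u v + dcoframe z u' v"
    and "dcoframe z u (v + v') = dcoframe z u v + dcoframe z u v'"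
    and "dcoframe z (a *s u) v = a *s dcoframe z u v"
    and "dcoframe z u (a *s v) = a *s dcoframe z u v"
    and "dcoframe z 0 v = 0" and "dcoframe z u 0 = 0"
proof -
  have lin: "linear (frechet_derivative (\<lambda>z. matrix_inv (M z) $ i $ k) (at z))" for i k
    by (rule has_derivative_linear[OF holo_onD(1)[OF holo_inv z]])
  show "dcoframe z (u + u') v = dcoframe z u v + dcoframe z u' v"
    by (simp add: dcoframe_def vec_eq_iff linear_add[OF lin] algebra_simps sum.distrib)
  show "dcoframe z u (v + v') = dcoframe z u v + dcoframe z u v'"
    by (simp add: dcoframe_def vec_eq_iff algebra_simps sum.distrib)
  show "dcoframe z (a *s u) v = a *s dcoframe z u v"
    by (simp add: dcoframe_def vec_eq_iff holo_onD(2)[OF holo_inv z] sum_distrib_left mult_ac)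
  show "dcoframe z u (a *s v) = a *s dcoframe z u v"
    by (simp add: dcoframe_def vec_eq_iff sum_distrib_left mult_ac)
  show "dcoframe z 0 v = 0"
    by (simp add: dcoframe_def vec_eq_iff linear_0[OF lin])
  show "dcoframe z u 0 = 0"
    by (simp add: dcoframe_def vec_eq_iff)
qed

lemma dcoframe_sum:
  assumes z: "z \<in> S"
  shows "dcoframe z (\<Sum>i\<in>I. a i *s f i) v = (\<Sum>i\<in>I. a i *s dcoframe z (f i) v)"
    and "dcoframe z u (\<Sum>i\<in>I. a i *s f i) = (\<Sum>i\<in>I. a i *s dcoframe z u (f i))"
proof -
  show "dcoframe z (\<Sum>i\<in>I. a i *s f i) v = (\<Sum>i\<in>I. a i *s dcoframe z (f i) v)"
    by (induction I rule: infinite_finite_induct) (simp_all add: dcoframe_linear[OF z])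
  show "dcoframe z u (\<Sum>i\<in>I. a i *s f i) = (\<Sum>i\<in>I. a i *s dcoframe z u (f i))"
    by (induction I rule: infinite_finite_induct) (simp_all add: dcoframe_linear[OF z])
qed

lemma dcoframe_expand:
  assumes z: "z \<in> S"
  shows "dcoframe z u v = (\<Sum>i\<in>UNIV. \<Sum>j\<in>UNIV.
    coframe (M z) u $ i *s (coframe (M z) v $ j *s dcoframe z (M z $ i) (M z $ j)))"
proof -
  have "dcoframe z (\<Sum>i\<in>UNIV. coframe (M z) u $ i *s M z $ i) (\<Sum>j\<in>UNIV. coframe (M z) v $ j *s M z $ j)
      = (\<Sum>i\<in>UNIV. \<Sum>j\<in>UNIV. coframe (M z) u $ i *s (coframe (M z) v $ j *s dcoframe z (M z $ i) (M z $ j)))"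
    by (subst dcoframe_sum(1)[OF z]) (simp only: dcoframe_sum(2)[OF z] vec.scale_sum_right)
  then show ?thesis by (simp only: coframe_expand[OF det_M[OF z]])
qed

text \<open>In terms of the dual coframe \<open>\<theta>\<close>, the fundamental form is \<open>\<i>/2 \<Sum> \<theta>\<^sub>k \<and> cnj \<theta>\<^sub>k\<close>, and
  \<open>torsion z u v w\<close> is \<open>\<Sum> d\<theta>\<^sub>k (u, v) * cnj (\<theta>\<^sub>k w)\<close>, i.e. essentially its (2,1)-part.\<close>

definition torsion :: "complex^'n \<Rightarrow> complex^'n \<Rightarrow> complex^'n \<Rightarrow> complex^'n \<Rightarrow> complex" where
  "torsion z u v w = (\<Sum>k\<in>UNIV. (dcoframe z u v $ k - dcoframe z v u $ k) * cnj (coframe (M z) w $ k))"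

lemma frechet_derivative_form:
  assumes z: "z \<in> S"
  shows "frechet_derivative (\<lambda>x. - Im (herm (frame_form (M x)) v w)) (at z) u
    = (\<Sum>k\<in>UNIV. - Im (coframe (M z) v $ k * cnj (dcoframe z u w $ k) + dcoframe z u v $ k * cnj (coframe (M z) w $ k)))"
proof -
  have "((\<lambda>x. - Im (\<Sum>k\<in>UNIV. coframe (M x) v $ k * cnj (coframe (M x) w $ k))) has_derivative
      (\<lambda>u. - Im (\<Sum>k\<in>UNIV. coframe (M z) v $ k * cnj (dcoframe z u w $ k) + dcoframe z u v $ k * cnj (coframe (M z) w $ k)))) (at z)"
    by (intro has_derivative_minus has_derivative_Im has_derivative_sum has_derivative_mult
        bounded_linear.has_derivative[OF bounded_linear_cnj] has_derivative_coframe z)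
  from fun_cong[OF frechet_derivative_at[OF this, symmetric], of u] show ?thesis
    unfolding herm_frame_form by (simp only: Im_sum sum_negf)
qed

text \<open>The product rule yields six terms. Since
  \<open>Im (a * cnj b) = - Im (b * cnj a)\<close>, every derivative can be moved to the
  unconjugated factor, and the terms then pair into antisymmetrised derivatives.\<close>

lemma ext_deriv2_form:
  assumes z: "z \<in> S"
  shows "ext_deriv2 (\<lambda>x v w. - Im (herm (frame_form (M x)) v w)) z u v w
    = - Im (torsion z u v w - torsion z u w v + torsion z v w u)"
proof -
  have "- Im (torsion z u v w - torsion z u w v + torsion z v w u)
     = (\<Sum>k\<in>UNIV. - Im ((dcoframe z u v $ k - dcoframe z v u $ k) * cnj (coframe (M z) w $ k)
         - (dcoframe z u w $ k - dcoframe z w u $ k) * cnj (coframe (M z) v $ k)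
         + (dcoframe z v w $ k - dcoframe z w v $ k) * cnj (coframe (M z) u $ k)))"
    unfolding torsion_def by (simp only: sum_subtractf sum.distrib sum_negf Im_sum minus_complex.sel plus_complex.sel)
  also have "\<dots> = ext_deriv2 (\<lambda>x v w. - Im (herm (frame_form (M x)) v w)) z u v w"
    unfolding ext_deriv2_def frechet_derivative_form[OF z] sum_subtractf[symmetric] sum.distrib[symmetric]
    by (rule sum.cong) (auto simp: algebra_simps)
  finally show ?thesis ..
qed

lemma torsion_scale:
  assumes z: "z \<in> S"
  shows "torsion z (a *s u) v w = a * torsion z u v w"
    and "torsion z u (a *s v) w = a * torsion z u v w"
    and "torsion z u v (a *s w) = cnj a * torsion z u v w"
  by (simp_all add: torsion_def dcoframe_linear[OF z] coframe_cscale sum_distrib_left algebra_simps)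

lemma closed_iff_dcoframe_sym:
  assumes z: "z \<in> S"
  shows "(\<forall>u v w. ext_deriv2 (\<lambda>x v w. - Im (herm (frame_form (M x)) v w)) z u v w = 0)
    \<longleftrightarrow> (\<forall>u v. dcoframe z u v = dcoframe z v u)"
proof
  assume "\<forall>u v. dcoframe z u v = dcoframe z v u"
  then have "torsion z u v w = 0" for u v w unfolding torsion_def by (metis (no_types, lifting) diff_self mult_zero_left sum.neutral)
  then show "\<forall>u v w. ext_deriv2 (\<lambda>x v w. - Im (herm (frame_form (M x)) v w)) z u v w = 0"
    by (simp add: ext_deriv2_form[OF z])
next
  assume "\<forall>u v w. ext_deriv2 (\<lambda>x v w. - Im (herm (frame_form (M x)) v w)) z u v w = 0"
  then have "ext_deriv2 (\<lambda>x v w. - Im (herm (frame_form (M x)) v w)) z u v w = 0" for u v w by blast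
  then have *: "Im (torsion z u v w - torsion z u w v + torsion z v w u) = 0" for u v w
    by (simp only: ext_deriv2_form[OF z] neg_equal_0_iff_equal)
  \<comment> \<open>replacing \<open>u, v\<close> with \<open>\<i> u, \<i> v\<close> changes the sign of the first term only\<close>
  have Im0: "Im (torsion z u v w) = 0" for u v w
    using *[of u v w] *[of "\<i> *s u" "\<i> *s v" w] by (simp add: torsion_scale[OF z])
  \<comment> \<open>Multiplying \<open>u\<close> by \<open>\<i>\<close> turns the real part into an
    imaginary part, so \<open>Im0\<close> covers both.\<close>
  have t0: "torsion z u v w = 0" for u v w
    using Im0[of u v w] Im0[of "\<i> *s u" v w] by (simp add: torsion_scale[OF z] complex_eq_iff)
  show "\<forall>u v. dcoframe z u v = dcoframe z v u"
  proof (intro allI)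
    fix u v
    \<comment> \<open>Taking the \<open>k\<close>-th frame vector as third argument extracts
      component \<open>k\<close>, since its coframe coordinates are \<open>axis k 1\<close>.\<close>
    have "dcoframe z u v $ k - dcoframe z v u $ k = torsion z u v (M z $ k)" for k
      unfolding torsion_def coframe_row[OF det_M[OF z]]
      by (simp add: axis_def if_distrib cong: if_cong)
    then show "dcoframe z u v = dcoframe z v u" using t0 by (simp add: vec_eq_iff)
  qed
qed

section \<open>From the exterior derivatives of the coframe to brackets of the frame fields\<close>

definition drow :: "complex^'n \<Rightarrow> 'n \<Rightarrow> complex^'n \<Rightarrow> complex^'n" where
  "drow z j u = frechet_derivative (\<lambda>x. M x $ j) (at z) u"

lemma holo_vec_row: "holo_vec_on S (\<lambda>x. M x $ j)"
  unfolding holo_vec_on_def using holo_M by blast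

text \<open>The coframe coordinates of the \<open>j\<close>-th frame field are constant. In their
  derivative one term varies the coframe with the field frozen, the other varies the field; the two
  must cancel.\<close>

lemma dcoframe_row:
  assumes z: "z \<in> S"
  shows "dcoframe z u (M z $ j) = - coframe (M z) (drow z j u)"
proof -
  have "dcoframe z u (M z $ j) $ k + coframe (M z) (drow z j u) $ k = 0" for k
  proof -
    let ?f = "\<lambda>x. \<Sum>i\<in>UNIV. M x $ j $ i * matrix_inv (M x) $ i $ k"
    have "(?f has_derivative (\<lambda>u. \<Sum>i\<in>UNIV. M z $ j $ i * frechet_derivative (\<lambda>z. matrix_inv (M z) $ i $ k) (at z) u
        + frechet_derivative (\<lambda>x. M x $ j $ i) (at z) u * matrix_inv (M z) $ i $ k)) (at z)"
      by (intro has_derivative_sum has_derivative_mult holo_onD(1)[OF holo_inv z] holo_onD(1)[OF holo_M z])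
    moreover have "(?f has_derivative (\<lambda>u. 0)) (at z)"
    proof (rule has_derivative_transform_within_open[OF has_derivative_const open_S z])
      fix x assume "x \<in> S"
      then show "axis j 1 $ k = ?f x"
        using coframe_row[OF det_M, of x j] by (simp add: coframe_nth[symmetric])
    qed
    ultimately have "(\<lambda>u. \<Sum>i\<in>UNIV. M z $ j $ i * frechet_derivative (\<lambda>z. matrix_inv (M z) $ i $ k) (at z) u
        + frechet_derivative (\<lambda>x. M x $ j $ i) (at z) u * matrix_inv (M z) $ i $ k) = (\<lambda>u. 0)"
      by (rule has_derivative_unique)
    from fun_cong[OF this, of u] show ?thesis
      unfolding dcoframe_def coframe_nth drow_def frechet_derivative_vec(2)[OF holo_vec_row z]
      by (simp add: sum.distrib)
  qed
  then show ?thesis by (simp add: vec_eq_iff eq_neg_iff_add_eq_0)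
qed

text \<open>On frame vectors the antisymmetrised \<open>dcoframe\<close> is minus the coframe of the
  bracket, and the coframe is injective; bilinearity extends the symmetry from frame vectors to all
  vectors.\<close>

lemma closed_iff_brackets:
  assumes z: "z \<in> S"
  shows "(\<forall>u v w. ext_deriv2 (\<lambda>x v w. - Im (herm (frame_form (M x)) v w)) z u v w = 0)
    \<longleftrightarrow> (\<forall>i j. drow z j (M z $ i) - drow z i (M z $ j) = 0)"
proof -
  let ?b = "\<lambda>i j. drow z j (M z $ i) - drow z i (M z $ j)"
  have row: "dcoframe z (M z $ i) (M z $ j) - dcoframe z (M z $ j) (M z $ i) = - coframe (M z) (?b i j)" for i j
    by (simp add: dcoframe_row[OF z] coframe_diff)
  have "(\<forall>u v. dcoframe z u v = dcoframe z v u) \<longleftrightarrow> (\<forall>i j. ?b i j = 0)"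
  proof
    assume *: "\<forall>u v. dcoframe z u v = dcoframe z v u"
    show "\<forall>i j. ?b i j = 0"
    proof (intro allI)
      fix i j
      have "dcoframe z (M z $ i) (M z $ j) = dcoframe z (M z $ j) (M z $ i)" using * by blast
      then have "coframe (M z) (?b i j) = 0" using row[of i j] by simp
      then show "?b i j = 0" using coframe_expand[OF det_M[OF z], of "?b i j"] by simp
    qed
  next
    assume *: "\<forall>i j. ?b i j = 0"
    have c0: "coframe (M z) 0 = 0" by (simp add: vec_eq_iff coframe_nth)
    have "dcoframe z (M z $ i) (M z $ j) - dcoframe z (M z $ j) (M z $ i) = - coframe (M z) 0" for i j
      using row[of i j] *[rule_format, of i j] by simp
    then have sym: "dcoframe z (M z $ i) (M z $ j) = dcoframe z (M z $ j) (M z $ i)" for i j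
      using c0 by simp
    show "\<forall>u v. dcoframe z u v = dcoframe z v u"
    proof (intro allI)
      fix u v
      have "dcoframe z u v = (\<Sum>j\<in>UNIV. \<Sum>i\<in>UNIV.
          coframe (M z) u $ i *s (coframe (M z) v $ j *s dcoframe z (M z $ i) (M z $ j)))"
        unfolding dcoframe_expand[OF z, of u v] by (rule sum.swap)
      also have "\<dots> = (\<Sum>j\<in>UNIV. \<Sum>i\<in>UNIV.
          coframe (M z) v $ j *s (coframe (M z) u $ i *s dcoframe z (M z $ j) (M z $ i)))"
        by (intro sum.cong refl) (subst sym, simp only: vector_smult_assoc mult.commute)
      also have "\<dots> = dcoframe z v u" by (rule dcoframe_expand[OF z, symmetric])
      finally show "dcoframe z u v = dcoframe z v u" .
    qed
  qed
  then show ?thesis using closed_iff_dcoframe_sym[OF z] by simp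
qed

end

text \<open>For a varying direction, expand it in the axes and use complex linearity. This makes the
  components of Lie brackets holomorphic.\<close>

lemma holo_on_frechet_derivative_along:
  assumes S: "open S" and f: "holo_on S f" and v: "\<And>k. holo_on S (\<lambda>z. v z $ k)"
  shows "holo_on S (\<lambda>z. frechet_derivative f (at z) (v z))"
proof (rule holo_on_cong[OF _ S])
  show "holo_on S (\<lambda>z. \<Sum>k\<in>UNIV. v z $ k * frechet_derivative f (at z) (axis k 1))"
    by (intro holo_on_sum holo_on_mult v holo_on_frechet_derivative S f)
  fix z assume z: "z \<in> S"
  have lin: "linear (frechet_derivative f (at z))" by (rule has_derivative_linear[OF holo_onD(1)[OF f z]])
  have "frechet_derivative f (at z) (v z) = frechet_derivative f (at z) (\<Sum>k\<in>UNIV. v z $ k *s axis k 1)"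
    by (simp only: basis_expansion)
  also have "\<dots> = (\<Sum>k\<in>UNIV. v z $ k * frechet_derivative f (at z) (axis k 1))"
    by (simp add: linear_sum[OF lin] holo_onD(2)[OF f z])
  finally show "(\<Sum>k\<in>UNIV. v z $ k * frechet_derivative f (at z) (axis k 1)) = frechet_derivative f (at z) (v z)" ..
qed

lemma (in complex_atlas) holo_funD:
  assumes "holo_fun A U f" "c \<in> A" "U \<subseteq> cdom c"
  shows "holo_on (coord c ` U) (f \<circ> chart_inv c)"
proof -
  have "holo_on (coord c ` (cdom c \<inter> U)) (f \<circ> chart_inv c)"
    using assms(1,2) unfolding holo_fun_def by (rule bspec)
  then show ?thesis using assms(3) by (simp add: Int_absorb1)
qed

context holomorphic_frame
begin

subsection \<open>The metric\<close>

abbreviation "W \<equiv> frame_complement X A s"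

lemma mem_complement:
  assumes c: "c \<in> A" "p \<in> cdom c"
  shows "p \<in> W \<longleftrightarrow> wedge s c p \<noteq> 0"
proof -
  have "p \<in> topspace X" using c openin_subset[OF openin_cdom] by blast
  moreover have "p \<in> divisor_support D \<longleftrightarrow> wedge s c p = 0"
  proof
    assume "p \<in> divisor_support D"
    then obtain U f where "(U, f) \<in> D" "p \<in> U" "f p = 0" unfolding divisor_support_def by blast
    then show "wedge s c p = 0" using support_wedge c by blast
  next
    assume "wedge s c p = 0"
    then show "p \<in> divisor_support D"
      using chart_mem_divisor[OF c(1)] c(2) unfolding divisor_support_def by blast
  qed
  ultimately show ?thesis by blast
qed

lemma open_complement_image:
  assumes c: "c \<in> A" shows "open (coord c ` (cdom c \<inter> W))"
proof -
  have "cdom c \<inter> W = {p \<in> cdom c. wedge s c p \<noteq> 0}" using mem_complement[OF c] by blast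
  moreover have "openin X {p \<in> cdom c. wedge s c p \<noteq> 0}"
    by (rule openin_nonzero[OF openin_cdom[OF c] holo_wedge[OF c]])
  ultimately show ?thesis using open_coord_image'[OF c, of "cdom c \<inter> W"] by simp
qed

abbreviation "local_matrix c \<equiv> \<lambda>z. frame_matrix s c (chart_inv c z)"

lemma holo_local_matrix:
  assumes c: "c \<in> A" shows "holo_on (coord c ` cdom c) (\<lambda>z. local_matrix c z $ i $ j)"
  using holo_funD[OF holo_field[OF c, of i j] c] by (simp add: frame_matrix_def o_def)

lemma local_frame:
  assumes c: "c \<in> A" shows "local_frame (coord c ` (cdom c \<inter> W)) (local_matrix c)"
proof
  show "open (coord c ` (cdom c \<inter> W))" by (rule open_complement_image[OF c])
  show "holo_on (coord c ` (cdom c \<inter> W)) (\<lambda>z. local_matrix c z $ i $ j)" for i j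
    by (rule holo_on_subset[OF holo_local_matrix[OF c]]) blast
  fix z assume "z \<in> coord c ` (cdom c \<inter> W)"
  then obtain p where "p \<in> cdom c" "p \<in> W" "z = coord c p" by blast
  then show "det (local_matrix c z) \<noteq> 0"
    using mem_complement[OF c] chart_inv_coord[OF c] unfolding wedge_def by simp
qed

lemma frame_metric_eq: "frame_metric s c p = frame_form (frame_matrix s c p)"
  unfolding frame_metric_def frame_form_def Let_def ..

lemma frame_matrix_row: "frame_matrix s c p $ i = s i c p"
  by (simp add: frame_matrix_def vec_eq_iff)

lemma det_frame_matrix: "c \<in> A \<Longrightarrow> p \<in> cdom c \<Longrightarrow> p \<in> W \<Longrightarrow> det (frame_matrix s c p) \<noteq> 0"
  using mem_complement unfolding wedge_def by blast

text \<open>The fields transform by the transition derivative, so the coordinates of a tangent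
  vector relative to them do not depend on the chart. This makes the metric
  chart-independent.\<close>

lemma coframe_transition:
  assumes c: "c \<in> A" "p \<in> cdom c" and d: "d \<in> A" "p \<in> cdom d" and p: "p \<in> W"
  shows "coframe (frame_matrix s d p) (transition_deriv c d p v) = coframe (frame_matrix s c p) v"
proof -
  let ?a = "coframe (frame_matrix s c p) v"
  note T = transition_deriv_linear[OF c(1) d(1) c(2) d(2)]
  have "transition_deriv c d p v = transition_deriv c d p (\<Sum>i\<in>UNIV. ?a $ i *s s i c p)"
    using coframe_expand[OF det_frame_matrix[OF c p], of v] by (simp add: frame_matrix_row)
  also have "\<dots> = (\<Sum>i\<in>UNIV. ?a $ i *s frame_matrix s d p $ i)"
    by (simp add: linear_sum[OF T(1)] T(2) frame_matrix_row field_transition[OF c(1) d(1) c(2) d(2)])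
  finally have "coframe (frame_matrix s d p) (transition_deriv c d p v) = (\<Sum>i\<in>UNIV. ?a $ i *s axis i 1)"
    by (simp add: coframe_sum coframe_cscale coframe_row[OF det_frame_matrix[OF d p]])
  then show ?thesis by (simp add: basis_expansion)
qed

lemma hermitian_frame_metric: "hermitian_metric A W (frame_metric s)"
  unfolding hermitian_metric_def frame_metric_eq
proof (intro conjI ballI allI impI)
  fix c assume c: "c \<in> A"
  show "herm (frame_form (frame_matrix s c p)) w v = cnj (herm (frame_form (frame_matrix s c p)) v w)" for p v w
    by (rule herm_frame_form_sym)
  show "0 < Re (herm (frame_form (frame_matrix s c p)) v v)" if "p \<in> cdom c \<inter> W" "v \<noteq> 0" for p v
    by (rule frame_form_positive[OF det_frame_matrix[OF c] that(2)]) (use that(1) in blast)+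
  interpret local_frame "coord c ` (cdom c \<inter> W)" "local_matrix c" by (rule local_frame[OF c])
  \<comment> \<open>The entries are sums of products of holomorphic functions with conjugates of
    holomorphic functions, hence smooth in the real sense.\<close>
  show "smooth_on (coord c ` (cdom c \<inter> W)) (\<lambda>z. frame_form (local_matrix c z) $ i $ j)" for i j
    unfolding smooth_on_def frame_form_def vec_lambda_beta
    by (intro allI Ck_on_sum Ck_on_mult Ck_on_bounded_linear[OF _ bounded_linear_cnj] holo_on_imp_Ck_on holo_inv open_S)
next
  fix c d p v w assume c: "c \<in> A" and d: "d \<in> A" and p: "p \<in> cdom c \<inter> cdom d \<inter> W"
  have "coframe (frame_matrix s d p) (transition_deriv c d p v) = coframe (frame_matrix s c p) v" for v
    using coframe_transition[OF c _ d] p by blast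
  then show "herm (frame_form (frame_matrix s d p)) (transition_deriv c d p v) (transition_deriv c d p w)
      = herm (frame_form (frame_matrix s c p)) v w"
    unfolding herm_frame_form by simp
qed

lemma unitary_frame_metric: "unitary_frame A W (frame_metric s) s"
  unfolding unitary_frame_def frame_metric_eq
proof (intro ballI allI)
  fix c p i j assume c: "c \<in> A" and p: "p \<in> cdom c \<inter> W"
  then have "det (frame_matrix s c p) \<noteq> 0" using det_frame_matrix by blast
  from herm_frame_form_rows[OF this, of i j]
  show "herm (frame_form (frame_matrix s c p)) (s i c p) (s j c p) = (if i = j then 1 else 0)"
    by (simp only: frame_matrix_row)
qed

lemma unitary_frame_unique:
  assumes h: "unitary_frame A W h s" and c: "c \<in> A" and p: "p \<in> cdom c" "p \<in> W"
  shows "h c p = frame_metric s c p"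
  unfolding frame_metric_eq
proof (rule herm_frame_form_unique[OF det_frame_matrix[OF c p]])
  show "herm (h c p) (frame_matrix s c p $ i) (frame_matrix s c p $ j) = (if i = j then 1 else 0)" for i j
    using h c p unfolding unitary_frame_def frame_matrix_row by blast
qed

lemma ricci_flat_frame_metric: "ricci_flat A W (frame_metric s)"
  unfolding ricci_flat_def
proof (intro ballI allI)
  fix c p j k assume c: "c \<in> A" and p: "p \<in> cdom c \<inter> W"
  interpret local_frame "coord c ` (cdom c \<inter> W)" "local_matrix c" by (rule local_frame[OF c])
  have "wirtinger j (wirtinger_bar k (\<lambda>z. ln (det (frame_metric s c (chart_inv c z))))) (coord c p) = 0"
  proof (rule wirtinger_wirtinger_bar_ln[OF open_S])
    show "holo_on (coord c ` (cdom c \<inter> W)) (\<lambda>z. det (matrix_inv (local_matrix c z)))"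
      by (intro holo_on_det holo_inv)
    show "det (matrix_inv (local_matrix c z)) \<noteq> 0" if "z \<in> coord c ` (cdom c \<inter> W)" for z
      using arg_cong[OF matrix_inv_left[OF det_M[OF that]], of det] by (auto simp: det_mul det_I)
  qed (use p in \<open>auto simp: frame_metric_eq det_frame_form\<close>)
  then show "ricci (frame_metric s) c p j k = 0" unfolding ricci_def by simp
qed

subsection \<open>The Kaehler condition\<close>

lemma holo_vec_field: "c \<in> A \<Longrightarrow> holo_vec_on (coord c ` cdom c) (s i c \<circ> chart_inv c)"
  using holo_funD[OF holo_field[of c i]] unfolding holo_vec_on_def by (simp add: o_def)

text \<open>A component of the bracket times the wedge product is zero everywhere: the first factor
  vanishes on \<open>W\<close>, the second off \<open>W\<close>. Cancelling the local equation
  \<open>wedge s c\<close> leaves a zero bracket.\<close>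

lemma lie_bracket_zero_dense:
  assumes c: "c \<in> A" and zero: "\<And>p. p \<in> cdom c \<Longrightarrow> p \<in> W \<Longrightarrow> lie_bracket (s i) (s j) c p = 0"
    and p: "p \<in> cdom c"
  shows "lie_bracket (s i) (s j) c p = 0"
proof -
  have opc: "open (coord c ` cdom c)" by (rule open_coord_image'[OF c openin_cdom[OF c]]) blast
  let ?f = "\<lambda>i. s i c \<circ> chart_inv c"
  have holo: "holo_fun A (cdom c) (\<lambda>p. lie_bracket (s i) (s j) c p $ k)" for k
  proof (rule holo_fun_chartI[OF c openin_cdom[OF c] order_refl])
    have "holo_on (coord c ` cdom c) (\<lambda>z. frechet_derivative (\<lambda>z. ?f i z $ k) (at z) (?f j z))" for i j
      using holo_vec_field[OF c] unfolding holo_vec_on_def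
      by (intro holo_on_frechet_derivative_along opc) blast+
    then have "holo_on (coord c ` cdom c) (\<lambda>z. frechet_derivative (\<lambda>z. ?f j z $ k) (at z) (?f i z)
        - frechet_derivative (\<lambda>z. ?f i z $ k) (at z) (?f j z))"
      by (intro holo_on_diff)
    then show "holo_on (coord c ` cdom c) ((\<lambda>p. lie_bracket (s i) (s j) c p $ k) \<circ> chart_inv c)"
    proof (rule holo_on_cong[OF _ opc])
      fix z assume z: "z \<in> coord c ` cdom c"
      then have "coord c (chart_inv c z) = z" using chart_inv_coord[OF c] by auto
      then show "frechet_derivative (\<lambda>z. ?f j z $ k) (at z) (?f i z)
        - frechet_derivative (\<lambda>z. ?f i z $ k) (at z) (?f j z)
        = ((\<lambda>p. lie_bracket (s i) (s j) c p $ k) \<circ> chart_inv c) z"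
        by (simp add: lie_bracket_def frechet_derivative_vec(2)[OF holo_vec_field[OF c] z])
    qed
  qed
  have "lie_bracket (s i) (s j) c p $ k = 0" for k
  proof (rule local_equation_cancel[OF local_equation_wedge[OF c] openin_cdom[OF c] order_refl holo _ _ p])
    show "holo_fun A (cdom c) (\<lambda>p. 0)" unfolding holo_fun_def o_def by (intro ballI holo_on_const)
    show "lie_bracket (s i) (s j) c q $ k * wedge s c q = 0 * wedge s c q" if q: "q \<in> cdom c" for q
      using zero[OF q] mem_complement[OF c q] by (cases "q \<in> W") simp_all
  qed
  then show ?thesis by (simp add: vec_eq_iff)
qed

lemma closed_iff_lie_brackets:
  assumes c: "c \<in> A" and p: "p \<in> cdom c" "p \<in> W"
  shows "(\<forall>u v w. ext_deriv2 (fundamental_form (frame_metric s) c) (coord c p) u v w = 0)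
    \<longleftrightarrow> (\<forall>i j. lie_bracket (s i) (s j) c p = 0)"
proof -
  interpret local_frame "coord c ` (cdom c \<inter> W)" "local_matrix c" by (rule local_frame[OF c])
  have row: "drow (coord c p) j u = frechet_derivative (s j c \<circ> chart_inv c) (at (coord c p)) u" for j u
    by (simp add: drow_def frame_matrix_row o_def)
  have "fundamental_form (frame_metric s) c = (\<lambda>x v w. - Im (herm (frame_form (local_matrix c x)) v w))"
    by (intro ext) (simp add: fundamental_form_def frame_metric_eq)
  moreover have "coord c p \<in> coord c ` (cdom c \<inter> W)" using p by blast
  ultimately show ?thesis
    using closed_iff_brackets[of "coord c p"]
    by (simp add: row frame_matrix_row chart_inv_coord[OF c p(1)] lie_bracket_def)
qed

text \<open>The coefficients are constants, so no derivatives of them appear and the bracket is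
  bilinear over them.\<close>

lemma lie_bracket_span:
  assumes c: "c \<in> A" and p: "p \<in> cdom c"
  shows "lie_bracket (\<lambda>c p. \<Sum>i\<in>UNIV. a i *s s i c p) (\<lambda>c p. \<Sum>j\<in>UNIV. b j *s s j c p) c p
    = (\<Sum>i\<in>UNIV. \<Sum>j\<in>UNIV. (a i * b j) *s lie_bracket (s i) (s j) c p)"
proof -
  let ?z = "coord c p"
  let ?D = "\<lambda>j. frechet_derivative (s j c \<circ> chart_inv c) (at ?z)"
  have z: "?z \<in> coord c ` cdom c" using p by blast
  note D = frechet_derivative_vec[OF holo_vec_field[OF c] z]
  have cs: "bounded_linear (\<lambda>v. b *s (v :: complex^'n))" for b
    by (auto simp: linear_conv_bounded_linear[symmetric] vec_eq_iff algebra_simps intro!: linearI)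
  have lin: "linear (?D j)" for j by (rule has_derivative_linear[OF D(1)])
  have deriv: "frechet_derivative ((\<lambda>p. \<Sum>j\<in>UNIV. b j *s s j c p) \<circ> chart_inv c) (at ?z) (\<Sum>i\<in>UNIV. a i *s s i c p)
      = (\<Sum>i\<in>UNIV. \<Sum>j\<in>UNIV. (a i * b j) *s ?D j (s i c p))" for a b
  proof -
    have "((\<lambda>z. \<Sum>j\<in>UNIV. b j *s (s j c \<circ> chart_inv c) z) has_derivative (\<lambda>u. \<Sum>j\<in>UNIV. b j *s ?D j u)) (at ?z)"
      by (intro has_derivative_sum bounded_linear.has_derivative[OF cs] D(1))
    then have "((\<lambda>p. \<Sum>j\<in>UNIV. b j *s s j c p) \<circ> chart_inv c has_derivative (\<lambda>u. \<Sum>j\<in>UNIV. b j *s ?D j u)) (at ?z)"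
      by (simp add: o_def)
    then have "frechet_derivative ((\<lambda>p. \<Sum>j\<in>UNIV. b j *s s j c p) \<circ> chart_inv c) (at ?z) u = (\<Sum>j\<in>UNIV. b j *s ?D j u)" for u
      by (rule fun_cong[OF frechet_derivative_at[symmetric]])
    then have "frechet_derivative ((\<lambda>p. \<Sum>j\<in>UNIV. b j *s s j c p) \<circ> chart_inv c) (at ?z) (\<Sum>i\<in>UNIV. a i *s s i c p)
        = (\<Sum>j\<in>UNIV. \<Sum>i\<in>UNIV. (a i * b j) *s ?D j (s i c p))"
      by (simp add: linear_sum[OF lin] D(3) vec.scale_sum_right vector_smult_assoc mult.commute)
    also have "\<dots> = (\<Sum>i\<in>UNIV. \<Sum>j\<in>UNIV. (a i * b j) *s ?D j (s i c p))" by (rule sum.swap)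
    finally show ?thesis .
  qed
  have "lie_bracket (\<lambda>c p. \<Sum>i\<in>UNIV. a i *s s i c p) (\<lambda>c p. \<Sum>j\<in>UNIV. b j *s s j c p) c p
    = (\<Sum>i\<in>UNIV. \<Sum>j\<in>UNIV. (a i * b j) *s ?D j (s i c p)) - (\<Sum>i\<in>UNIV. \<Sum>j\<in>UNIV. (b i * a j) *s ?D j (s i c p))"
    unfolding lie_bracket_def by (simp only: deriv)
  also have "(\<Sum>i\<in>UNIV. \<Sum>j\<in>UNIV. (b i * a j) *s ?D j (s i c p)) = (\<Sum>i\<in>UNIV. \<Sum>j\<in>UNIV. (a i * b j) *s ?D i (s j c p))"
    by (subst sum.swap) (simp only: mult.commute)
  also have "(\<Sum>i\<in>UNIV. \<Sum>j\<in>UNIV. (a i * b j) *s ?D j (s i c p)) - \<dots>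
      = (\<Sum>i\<in>UNIV. \<Sum>j\<in>UNIV. (a i * b j) *s lie_bracket (s i) (s j) c p)"
    unfolding lie_bracket_def by (simp only: sum_subtractf[symmetric] vec.scale_right_diff_distrib)
  finally show ?thesis .
qed

lemma abelian_iff: "abelian A (vfield_span s) \<longleftrightarrow> (\<forall>c\<in>A. \<forall>p\<in>cdom c. \<forall>i j. lie_bracket (s i) (s j) c p = 0)"
proof
  assume ab: "abelian A (vfield_span s)"
  have "s i \<in> vfield_span s" for i
  proof -
    have "s i = (\<lambda>c p. \<Sum>k\<in>UNIV. (if k = i then 1 else 0) *s s k c p)"
      by (intro ext) (simp add: vec_eq_iff if_distrib[of "\<lambda>x. x * _"] cong: if_cong)
    then show ?thesis
      unfolding vfield_span_def by (intro CollectI exI conjI TrueI)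
  qed
  then show "\<forall>c\<in>A. \<forall>p\<in>cdom c. \<forall>i j. lie_bracket (s i) (s j) c p = 0"
    using ab unfolding abelian_def by blast
next
  assume *: "\<forall>c\<in>A. \<forall>p\<in>cdom c. \<forall>i j. lie_bracket (s i) (s j) c p = 0"
  show "abelian A (vfield_span s)"
    unfolding abelian_def
  proof (intro ballI)
    fix \<zeta> \<xi> c p assume "\<zeta> \<in> vfield_span s" "\<xi> \<in> vfield_span s" and c: "c \<in> A" "p \<in> cdom c"
    then obtain a b where "\<zeta> = (\<lambda>c p. \<Sum>i\<in>UNIV. a i *s s i c p)" "\<xi> = (\<lambda>c p. \<Sum>j\<in>UNIV. b j *s s j c p)"
      unfolding vfield_span_def by blast
    then show "lie_bracket \<zeta> \<xi> c p = 0"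
      using lie_bracket_span[OF c, of a b] *[rule_format, OF c] by simp
  qed
qed

lemma kaehler_iff_abelian: "kaehler A W (frame_metric s) \<longleftrightarrow> abelian A (vfield_span s)"
proof -
  have "kaehler A W (frame_metric s) \<longleftrightarrow> (\<forall>c\<in>A. \<forall>p\<in>cdom c \<inter> W. \<forall>i j. lie_bracket (s i) (s j) c p = 0)"
    unfolding kaehler_def using hermitian_frame_metric closed_iff_lie_brackets by blast
  also have "\<dots> \<longleftrightarrow> (\<forall>c\<in>A. \<forall>p\<in>cdom c. \<forall>i j. lie_bracket (s i) (s j) c p = 0)"
    using lie_bracket_zero_dense by blast
  finally show ?thesis unfolding abelian_iff .
qed

end

section \<open>From generation at the general point to the theorem\<close>

lemma wedge_nonzero:
  assumes "generate_tangent_space A s p" "c \<in> A" "p \<in> cdom c"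
  shows "wedge s c p \<noteq> 0"
proof -
  have "rows (frame_matrix s c p) = range (\<lambda>i. s i c p)"
    by (auto simp: rows_def row_def frame_matrix_def vec_lambda_eta)
  then have "vec.span (rows (frame_matrix s c p)) = UNIV"
    using assms unfolding generate_tangent_space_def by simp
  then show ?thesis
    unfolding wedge_def invertible_det_nz[symmetric] invertible_left_inverse
    by (simp add: matrix_left_invertible_span_rows_gen)
qed

theorem mainTheorem1:
  fixes X :: "'a topology"
    and A :: "('a, complex^'n) chart set"
    and s :: "'n \<Rightarrow> ('a, 'n) vfield"
  assumes "compact_complex_manifold X A"
    and "almost_homogeneous TYPE('e::euclidean_space) X A"
    and "\<And>i. holomorphic_vector_field A (s i)"
    and "holds_at_general_point X A (generate_tangent_space A s)"
  shows "holo_section A (anticanonical_bundle A) (wedge s) \<and>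
    section_zeros (anticanonical_bundle A) (wedge s) = divisor_support (frame_divisor X A s) \<and>
    frame_divisor X A s \<in> complete_linear_system X A (anticanonical_bundle A) \<and>
    hermitian_metric A (frame_complement X A s) (frame_metric s) \<and>
    unitary_frame A (frame_complement X A s) (frame_metric s) s \<and>
    (\<forall>h. hermitian_metric A (frame_complement X A s) h \<and>
         unitary_frame A (frame_complement X A s) h s \<longrightarrow>
         (\<forall>c\<in>A. \<forall>p\<in>cdom c \<inter> frame_complement X A s. h c p = frame_metric s c p)) \<and>
    ricci_flat A (frame_complement X A s) (frame_metric s) \<and>
    (kaehler A (frame_complement X A s) (frame_metric s) \<longleftrightarrow> abelian A (vfield_span s))"
proof -
  have atlas: "is_atlas holo_vec_on X A" and conn: "connected_space X"
    using assms(1) unfolding compact_complex_manifold_def is_manifold_def by blast+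
  interpret complex_atlas X A by unfold_locales (rule atlas)
  \<comment> \<open>The exceptional analytic set is a subset of \<open>topspace X\<close> different
    from it, so it misses some point.\<close>
  obtain p where "p \<in> topspace X" "generate_tangent_space A s p"
    using assms(4) unfolding holds_at_general_point_def analytic_subset_def by blast
  moreover from this obtain c where "c \<in> A" "p \<in> cdom c"
    using chart_at by blast
  ultimately have "\<exists>c\<in>A. \<exists>p\<in>cdom c. wedge s c p \<noteq> 0"
    using wedge_nonzero by (intro bexI)
  then interpret holomorphic_frame X A s
    by unfold_locales (rule assms(3), rule conn)
  have "\<forall>c\<in>A. \<forall>p\<in>cdom c \<inter> frame_complement X A s. h c p = frame_metric s c p"
    if "unitary_frame A (frame_complement X A s) h s" for h
    using unitary_frame_unique[OF that] by blast
  then show ?thesis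
    by (intro conjI allI impI holo_section_wedge section_zeros_eq_support divisor_in_anticanonical_system
      hermitian_frame_metric unitary_frame_metric ricci_flat_frame_metric kaehler_iff_abelian) (elim conjE)
qed

end
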